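(* For the generic continuous function $f\in C(\Omega)$ we have $\partial^-S_f(\alpha_{f,\max}^* )=-\infty$ and $\partial^+S_f(\alpha_{f,\min}^* )=\infty$.
   Context: $\Omega=\{0,1\}^{\mathbb N}$ ($\mathbb N=\{1,2,\dots\}$) with the metric $d(\omega,\omega')=\sum_{k\ge1}|\omega_k-\omega'_k|2^{-k}$; $\sigma:\Omega\to\Omega$ is the one-sided shift, $(\sigma\omega)_k=\omega_{k+1}$. $C(\Omega)$ is the space of continuous functions $\Omega\to\mathbb R$ with the supremum norm. A property holds for the generic $f\in C(\Omega)$ if the set of $f$ having it is the complement of a set of first category (a countable union of nowhere dense sets) in $C(\Omega)$. For $f\in C(\Omega)$ and $\alpha\in\mathbb R$, $E_f(\alpha)=\{\omega\in\Omega:\lim_{N\to\infty}\frac1N\sum_{n=1}^N f(\sigma^n\omega)=\alpha\}$ and the Birkhoff spectrum is $S_f:\mathbb R\to[0,1]$, $S_f(\alpha)=\dim_H E_f(\alpha)$ (Hausdorff dimension with respect to $d$; $\dim_H\emptyset=0$). $\alpha_{f,\max}^*=\sup\{\alpha\in\mathbb R:E_f(\alpha)\ne\emptyset\}$ and $\alpha_{f,\min}^*=\inf\{\alpha\in\mathbb R:E_f(\alpha)\ne\emptyset\}$. For $\varphi:\mathbb R\to\mathbb R$, $\partial^-\varphi(\alpha)$ and $\partial^+\varphi(\alpha)$ denote the left-hand and right-hand derivatives of $\varphi$ at $\alpha$, as limits of difference quotients in $[-\infty,\infty]$. *)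

theory Defs
  imports "HOL-Analysis.Analysis"
begin

section \<open>The one-sided full shift\<close>

text \<open>
  The sequence space is a type of its own, so that it carries the weighted metric below instead of
  the library's instances for functions. Coordinates are numbered from 0: the \<open>k\<close>-th coordinate
  here is \<open>\<omega>\<^bsub>k+1\<^esub>\<close> in the usual numbering, which explains the weight \<open>1 / 2 ^ Suc k\<close>.
\<close>

typedef binseq = "UNIV :: (nat \<Rightarrow> bool) set"
  morphisms coord Binseq
  by simp

lemma coord_Binseq [simp]: "coord (Binseq x) = x"
  by (simp add: Binseq_inverse)

lemma Binseq_coord [simp]: "Binseq (coord w) = w"
  by (simp add: coord_inverse)

lemma binseq_eqI: "(\<And>k. coord v k = coord w k) \<Longrightarrow> v = w"
  by (subst coord_inject[symmetric]) (rule ext)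

lemma summable_halves: "summable (\<lambda>k. 1 / 2 ^ Suc k :: real)"
  using power_half_series by (auto simp: sums_iff power_one_over)

lemma summable_dist_binseq:
  "summable (\<lambda>k. \<bar>of_bool (x k) - of_bool (y k)\<bar> / 2 ^ Suc k :: real)"
  by (rule summable_comparison_test'[OF summable_halves, of 0]) (auto simp: field_simps)

instantiation binseq :: metric_space
begin

definition dist_binseq :: "binseq \<Rightarrow> binseq \<Rightarrow> real" where
  "dist v w = (\<Sum>k. \<bar>of_bool (coord v k) - of_bool (coord w k)\<bar> / 2 ^ Suc k)"

definition uniformity_binseq :: "(binseq \<times> binseq) filter" where
  "uniformity_binseq = (INF e\<in>{0 <..}. principal {(x, y). dist x y < e})"

definition open_binseq :: "binseq set \<Rightarrow> bool" where
  "open_binseq U = (\<forall>x\<in>U. \<forall>\<^sub>F (x', y) in uniformity. x' = x \<longrightarrow> y \<in> U)"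

instance
proof
  fix u v w :: binseq
  show "dist u v = 0 \<longleftrightarrow> u = v"
  proof
    assume "dist u v = 0"
    then have "\<forall>k. \<bar>of_bool (coord u k) - of_bool (coord v k)\<bar> / 2 ^ Suc k = (0::real)"
      unfolding dist_binseq_def
      by (subst (asm) suminf_eq_zero_iff[OF summable_dist_binseq]) auto
    then show "u = v"
      by (intro binseq_eqI) (simp add: of_bool_eq_iff)
  qed (simp add: dist_binseq_def)
  show "dist u v \<le> dist u w + dist v w"
    unfolding dist_binseq_def
    by (subst suminf_add[OF summable_dist_binseq summable_dist_binseq],
        rule suminf_le[OF _ summable_dist_binseq
          summable_add[OF summable_dist_binseq summable_dist_binseq]])
       (auto simp: field_simps)
qed (simp_all add: uniformity_binseq_def open_binseq_def)

end

definition shift :: "binseq \<Rightarrow> binseq" where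
  "shift w = Binseq (\<lambda>k. coord w (Suc k))"

lemma dist_binseq_le:
  assumes "\<And>k. k < n \<Longrightarrow> coord v k = coord w k"
  shows "dist v w \<le> 1 / 2 ^ n"
proof -
  have "dist v w = (\<Sum>k. \<bar>of_bool (coord v (k + n)) - of_bool (coord w (k + n))\<bar> / 2 ^ Suc (k + n))"
    unfolding dist_binseq_def
    by (subst suminf_split_initial_segment[OF summable_dist_binseq, of _ _ n]) (simp add: assms)
  also have "\<dots> \<le> (\<Sum>k. 1 / 2 ^ Suc k * (1 / 2 ^ n))"
    by (rule suminf_le[OF _ summable_ignore_initial_segment[OF summable_dist_binseq]
          summable_mult2[OF summable_halves]])
       (auto simp: field_simps power_add)
  also have "\<dots> = 1 / 2 ^ n"
    using power_half_series
    by (subst suminf_mult2[OF summable_halves, symmetric]) (simp add: sums_iff power_one_over)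
  finally show ?thesis .
qed

lemma compact_UNIV_binseq: "compact (UNIV :: binseq set)"
proof -
  have "compact_space (product_topology (\<lambda>_::nat. euclidean :: bool topology) UNIV)"
    by (subst compact_space_product_topology)
       (auto simp: compact_space_def intro!: finite_imp_compact)
  then have "compact (UNIV :: (nat \<Rightarrow> bool) set)"
    by (simp add: euclidean_product_topology compact_space_def)
  moreover have "continuous_on UNIV Binseq"
  proof (rule continuous_on_open_vimage[THEN iffD2, rule_format])
    fix U :: "binseq set" assume U: "open U"
    show "open (Binseq -` U \<inter> UNIV)"
    proof (subst open_subopen, intro ballI)
      fix x assume "x \<in> Binseq -` U \<inter> UNIV"
      then obtain e where e: "e > 0" "ball (Binseq x) e \<subseteq> U"
        using U by (auto elim: openE)
      obtain n where n: "1 / 2 ^ n < e"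
        using real_arch_pow_inv[of e "1/2"] e by (auto simp: power_one_over)
      let ?C = "{y. \<forall>k\<in>{..<n}. y k \<in> {x k}}"
      have "open ?C"
        using product_topology_basis'[of "{..<n}" "\<lambda>k. {x k}" "\<lambda>k. k"]
        by (simp add: open_discrete)
      moreover have "?C \<subseteq> Binseq -` U"
      proof
        fix y assume "y \<in> ?C"
        then have "dist (Binseq x) (Binseq y) \<le> 1 / 2 ^ n"
          by (intro dist_binseq_le) simp
        then show "y \<in> Binseq -` U"
          using n e by auto
      qed
      ultimately show "\<exists>T. open T \<and> x \<in> T \<and> T \<subseteq> Binseq -` U \<inter> UNIV"
        by (intro exI[of _ ?C]) auto
    qed
  qed simp
  ultimately have "compact (range Binseq)"
    by (rule compact_continuous_image[rotated])
  moreover have "range Binseq = UNIV"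
    by (metis Binseq_coord surj_def)
  ultimately show ?thesis by simp
qed

text \<open>
  By compactness the library type \<open>binseq \<Rightarrow>\<^sub>C real\<close> of bounded continuous functions with the
  supremum norm is the space of all continuous functions.
\<close>

lemma continuous_imp_bcontfun_binseq:
  fixes g :: "binseq \<Rightarrow> real"
  assumes "continuous_on UNIV g"
  shows "g \<in> bcontfun"
  using assms compact_continuous_image[OF assms compact_UNIV_binseq]
  by (simp add: bcontfun_def compact_imp_bounded)


section \<open>Generic properties\<close>

definition nowhere_dense :: "'a::topological_space set \<Rightarrow> bool" where
  "nowhere_dense A \<longleftrightarrow> interior (closure A) = {}"

definition first_category :: "'a::topological_space set \<Rightarrow> bool" where
  "first_category A \<longleftrightarrow> (\<exists>B :: nat \<Rightarrow> 'a set. (\<forall>n. nowhere_dense (B n)) \<and> A = (\<Union>n. B n))"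

definition generic :: "('a::topological_space \<Rightarrow> bool) \<Rightarrow> bool" where
  "generic P \<longleftrightarrow> first_category (- {x. P x})"


section \<open>Hausdorff dimension\<close>

definition hausdorff_premeasure :: "real \<Rightarrow> real \<Rightarrow> 'a::metric_space set \<Rightarrow> ennreal" where
  "hausdorff_premeasure s \<delta> A =
     (INF U \<in> {U :: nat \<Rightarrow> 'a set. A \<subseteq> (\<Union>i. U i) \<and> (\<forall>i. bounded (U i) \<and> diameter (U i) \<le> \<delta>)}.
        (\<Sum>i. ennreal (diameter (U i) powr s)))"

definition hausdorff_measure :: "real \<Rightarrow> 'a::metric_space set \<Rightarrow> ennreal" where
  "hausdorff_measure s A = (SUP \<delta> \<in> {0<..}. hausdorff_premeasure s \<delta> A)"

text \<open>
  Only exponents \<open>s > 0\<close> are used, which does not change the infimum: \<open>0 powr 0 = 0\<close> would make the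
  case \<open>s = 0\<close> differ from counting measure. In particular the empty set has dimension 0.
\<close>

definition hausdorff_dim :: "'a::metric_space set \<Rightarrow> ereal" where
  "hausdorff_dim A = (INF s \<in> {s::real. 0 < s \<and> hausdorff_measure s A = 0}. ereal s)"


section \<open>Birkhoff spectrum\<close>

definition birkhoff_level :: "(binseq \<Rightarrow>\<^sub>C real) \<Rightarrow> real \<Rightarrow> binseq set" where
  "birkhoff_level f \<alpha> =
     {w. (\<lambda>N. (\<Sum>n=1..N. apply_bcontfun f ((shift ^^ n) w)) / real N) \<longlonglongrightarrow> \<alpha>}"

definition birkhoff_spectrum :: "(binseq \<Rightarrow>\<^sub>C real) \<Rightarrow> real \<Rightarrow> real" where
  "birkhoff_spectrum f \<alpha> = real_of_ereal (hausdorff_dim (birkhoff_level f \<alpha>))"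

text \<open>The conversion from the extended reals is harmless, since all dimensions lie in \<open>[0, 1]\<close>:\<close>

lemma hausdorff_measure_binseq_eq_0:
  fixes A :: "binseq set"
  assumes "s > 1"
  shows "hausdorff_measure s A = 0"
proof -
  have "hausdorff_premeasure s \<delta> A = 0" if "\<delta> > 0" for \<delta>
  proof -
    define U where "U n i = (if i < (2::nat) ^ n then {w. \<forall>k<n. coord w k = bit i k} else {})" for n i
    have U: "bounded (U n i) \<and> diameter (U n i) \<le> 1 / 2 ^ n" for n i
    proof -
      have d: "dist v w \<le> 1 / 2 ^ n" if "v \<in> U n i" "w \<in> U n i" for v w
        using that by (intro dist_binseq_le) (auto simp: U_def split: if_splits)
      have "bounded (U n i)"
        using compact_imp_bounded[OF compact_UNIV_binseq] by (rule bounded_subset) simp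
      moreover have "diameter (U n i) \<le> 1 / 2 ^ n"
      proof (cases "U n i = {}")
        case False
        then show ?thesis
          unfolding diameter_def using d by (auto intro!: cSUP_least)
      qed simp
      ultimately show ?thesis by blast
    qed
    have cover: "A \<subseteq> (\<Union>i. U n i)" for n
    proof
      fix w
      let ?i = "horner_sum of_bool 2 (map (coord w) [0..<n]) :: nat"
      have "?i < 2 ^ n"
        using horner_sum_of_bool_2_less[of "map (coord w) [0..<n]", where ?'a = nat] by simp
      moreover have "\<forall>k<n. coord w k = bit ?i k"
        by (simp add: bit_horner_sum_bit_iff)
      ultimately have "w \<in> U n ?i" by (simp add: U_def)
      then show "w \<in> (\<Union>i. U n i)" by blast
    qed
    have le: "hausdorff_premeasure s \<delta> A \<le> ennreal ((2 powr (1 - s)) ^ n)" if n: "1 / 2 ^ n \<le> \<delta>" for n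
    proof -
      have "hausdorff_premeasure s \<delta> A \<le> (\<Sum>i. ennreal (diameter (U n i) powr s))"
        unfolding hausdorff_premeasure_def
        by (rule INF_lower) (use U cover n order_trans in blast)
      also have "\<dots> = (\<Sum>i<2^n. ennreal (diameter (U n i) powr s))"
        by (rule suminf_finite) (auto simp: U_def)
      also have "\<dots> \<le> (\<Sum>i<(2::nat)^n. ennreal ((1 / 2 ^ n) powr s))"
        using U assms by (intro sum_mono ennreal_leI powr_mono2 diameter_ge_0) auto
      also have "\<dots> = ennreal (2 ^ n * (1 / 2 ^ n) powr s)"
        by (simp add: ennreal_mult ennreal_power[symmetric])
      also have "2 ^ n * (1 / 2 ^ n) powr s = (2 powr (1 - s)) ^ n"
      proof -
        have "1 / 2 ^ n = (2::real) powr - real n"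
          by (simp add: powr_minus_divide powr_realpow)
        then have "2 ^ n * (1 / 2 ^ n) powr s = 2 powr real n * 2 powr (- real n * s)"
          by (simp add: powr_powr powr_realpow)
        also have "\<dots> = 2 powr ((1 - s) * real n)"
          unfolding powr_add[symmetric] by (simp add: algebra_simps)
        also have "\<dots> = (2 powr (1 - s)) ^ n"
          by (simp add: powr_powr[symmetric] powr_realpow)
        finally show ?thesis .
      qed
      finally show ?thesis .
    qed
    have ev: "\<forall>\<^sub>F n in sequentially. 1 / 2 ^ n \<le> \<delta>"
      using order_tendstoD(2)[OF LIMSEQ_power_zero[of "1/2::real"] \<open>\<delta> > 0\<close>]
      by (rule eventually_mono) (simp_all add: power_one_over)
    have "(\<lambda>n. ennreal ((2 powr (1 - s)) ^ n)) \<longlonglongrightarrow> ennreal 0"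
      using assms by (intro tendsto_ennrealI LIMSEQ_power_zero) (simp add: powr_less_one)
    then have "hausdorff_premeasure s \<delta> A \<le> ennreal 0"
      by (rule tendsto_lowerbound[OF _ eventually_mono[OF ev le]]) simp_all
    then show ?thesis by simp
  qed
  then show ?thesis
    unfolding hausdorff_measure_def by (auto intro!: antisym SUP_least)
qed

lemma hausdorff_dim_binseq:
  fixes A :: "binseq set"
  shows "0 \<le> hausdorff_dim A" "hausdorff_dim A \<le> 1"
proof -
  show "0 \<le> hausdorff_dim A"
    unfolding hausdorff_dim_def by (rule INF_greatest) simp
  show "hausdorff_dim A \<le> 1"
  proof (rule ereal_le_epsilon2)
    fix e :: real assume "e > 0"
    then have "hausdorff_dim A \<le> ereal (1 + e)"
      unfolding hausdorff_dim_def by (intro INF_lower) (simp add: hausdorff_measure_binseq_eq_0)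
    also have "ereal (1 + e) = 1 + ereal e"
      unfolding one_ereal_def by (rule plus_ereal.simps(1)[symmetric])
    finally show "hausdorff_dim A \<le> 1 + ereal e" .
  qed
qed

definition alpha_max :: "(binseq \<Rightarrow>\<^sub>C real) \<Rightarrow> real" where
  "alpha_max f = Sup {\<alpha>. birkhoff_level f \<alpha> \<noteq> {}}"

definition alpha_min :: "(binseq \<Rightarrow>\<^sub>C real) \<Rightarrow> real" where
  "alpha_min f = Inf {\<alpha>. birkhoff_level f \<alpha> \<noteq> {}}"

text \<open>The set of levels in \<open>alpha_max\<close> and \<open>alpha_min\<close> is nonempty and bounded:\<close>

lemma birkhoff_level_nonempty: "\<exists>\<alpha>. birkhoff_level f \<alpha> \<noteq> {}"
proof -
  let ?w = "Binseq (\<lambda>_. False)"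
  have "(shift ^^ n) ?w = ?w" for n
    by (induction n) (simp_all add: shift_def)
  then have "?w \<in> birkhoff_level f (apply_bcontfun f ?w)"
    unfolding birkhoff_level_def
    by (auto intro!: tendsto_eventually eventually_sequentiallyI[of 1])
  then show ?thesis by blast
qed

lemma birkhoff_level_bounded:
  assumes "birkhoff_level f \<alpha> \<noteq> {}"
  shows "\<bar>\<alpha>\<bar> \<le> norm f"
proof -
  from assms obtain w
    where "(\<lambda>N. (\<Sum>n=1..N. apply_bcontfun f ((shift ^^ n) w)) / real N) \<longlonglongrightarrow> \<alpha>"
    by (auto simp: birkhoff_level_def)
  then have lim: "(\<lambda>N. \<bar>(\<Sum>n=1..N. apply_bcontfun f ((shift ^^ n) w)) / real N\<bar>) \<longlonglongrightarrow> \<bar>\<alpha>\<bar>"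
    by (rule tendsto_rabs)
  have "\<bar>(\<Sum>n=1..N. apply_bcontfun f ((shift ^^ n) w)) / real N\<bar> \<le> norm f" if "N \<ge> 1" for N
  proof -
    have "\<bar>\<Sum>n=1..N. apply_bcontfun f ((shift ^^ n) w)\<bar> \<le> (\<Sum>n=1..N. norm f)"
      using norm_bounded[of f] by (intro order_trans[OF sum_abs] sum_mono) simp
    then show ?thesis
      using that by (simp add: field_simps)
  qed
  then show ?thesis
    by (intro tendsto_upperbound[OF lim]) (auto intro!: eventually_sequentiallyI[of 1])
qed


section \<open>One-sided derivatives in the extended reals\<close>

definition has_left_derivative :: "(real \<Rightarrow> real) \<Rightarrow> ereal \<Rightarrow> real \<Rightarrow> bool" where
  "has_left_derivative \<phi> D a \<longleftrightarrow> ((\<lambda>x. ereal ((\<phi> x - \<phi> a) / (x - a))) \<longlongrightarrow> D) (at_left a)"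

definition has_right_derivative :: "(real \<Rightarrow> real) \<Rightarrow> ereal \<Rightarrow> real \<Rightarrow> bool" where
  "has_right_derivative \<phi> D a \<longleftrightarrow> ((\<lambda>x. ereal ((\<phi> x - \<phi> a) / (x - a))) \<longlongrightarrow> D) (at_right a)"

end

theory Submission
  imports Defs "HOL-Probability.Infinite_Product_Measure"
begin

text \<open>
  The spectrum of the generic \<open>f\<close> vanishes at its maximal level, because a small reward for
  \<open>q\<close>-periodicity forces all near-maximizing orbits to be almost periodic, hence to have small
  entropy. On the other hand, if \<open>g\<close> depends on finitely many coordinates and \<open>f\<close> is close to \<open>g\<close>,
  then flipping one of the \<open>l\<close> letters of a maximizing word of length \<open>l\<close> gives \<open>l\<close> words
  whose Birkhoff sums drop at most by a constant \<open>C\<close> independent of \<open>l\<close>. Mixing such words into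
  near-maximizing orbits with a frequency proportional to \<open>t\<close> reaches the level \<open>alpha_max f - t\<close> on
  a set whose dimension is at least of order \<open>t * log 2 l / C\<close>, and \<open>l\<close> is arbitrary. The minimal
  level is treated by passing to \<open>- f\<close>.
\<close>

section \<open>Birkhoff sums\<close>

text \<open>A merely continuous \<open>f\<close> need not have bounded distortion: Birkhoff sums of
  length n at two points agreeing in n coordinates may differ by an unbounded, though sublinear,
  amount. The combinatorial steps are therefore made for a function of finitely many coordinates,
  where altering one coordinate costs a bounded amount, and are carried to nearby functions with an
  error of small slope in n.

  Each half of the difference quotient is treated at a fixed precision, an exponent s or a slope M,
  because at fixed precision it can be arranged on a whole ball around a perturbed function. Such
  balls lie arbitrarily near every function, and countably many precisions suffice. The radius may
  depend on l: taking it at most 1/(2l) makes the passage from \<open>g\<close> to a neighbour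
  change a sum of length l by at most 1/2, which is how C stays independent of l.

  A flipped word loses at most C. About 2C/t letters of control per word dilute this to a loss rate
  of at most t/2, which leaves room for the errors of the control, while the choice of words still
  yields log 2 l bits in roughly 2C/t letters.\<close>

definition agree :: "nat \<Rightarrow> binseq \<Rightarrow> binseq \<Rightarrow> bool" where
  "agree n v w \<longleftrightarrow> (\<forall>k<n. coord v k = coord w k)"

definition depends_on :: "nat \<Rightarrow> (binseq \<Rightarrow>\<^sub>C real) \<Rightarrow> bool" where
  "depends_on m g \<longleftrightarrow> (\<forall>v w. agree m v w \<longrightarrow> apply_bcontfun g v = apply_bcontfun g w)"

definition bsum :: "(binseq \<Rightarrow>\<^sub>C real) \<Rightarrow> nat \<Rightarrow> binseq \<Rightarrow> real" where
  "bsum f n w = (\<Sum>i<n. apply_bcontfun f ((shift ^^ i) w))"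

lemma coord_funpow_shift [simp]: "coord ((shift ^^ i) w) k = coord w (k + i)"
  by (induction i arbitrary: k) (simp_all add: shift_def)

lemma shift_funpow_add: "(shift ^^ (m + n)) w = (shift ^^ n) ((shift ^^ m) w)"
  by (rule binseq_eqI) (simp add: add_ac)

lemma agree_mono: "agree n v w \<Longrightarrow> m \<le> n \<Longrightarrow> agree m v w"
  by (auto simp: agree_def)

lemma dist_less_imp_agree:
  assumes "dist v w < 1 / 2 ^ n"
  shows "agree n v w"
  unfolding agree_def
proof (intro allI impI, rule ccontr)
  fix k assume k: "k < n" and ne: "coord v k \<noteq> coord w k"
  let ?a = "\<lambda>k. \<bar>of_bool (coord v k) - of_bool (coord w k)\<bar> / 2 ^ Suc k :: real"
  have "1 / 2 ^ n \<le> (1 / 2 ^ Suc k :: real)"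
    using k by (intro divide_left_mono power_increasing) auto
  also have "\<dots> = sum ?a {k}"
    using ne by auto
  also have "\<dots> \<le> dist v w"
    unfolding dist_binseq_def
    by (rule sum_le_suminf[OF summable_dist_binseq]) auto
  finally show False using assms by simp
qed

lemma depends_on_continuous:
  fixes h :: "binseq \<Rightarrow> real"
  assumes "\<And>v w. agree m v w \<Longrightarrow> h v = h w"
  shows "continuous_on UNIV h"
  unfolding continuous_on_iff
proof (intro ballI allI impI)
  fix x :: binseq and e :: real assume "e > 0"
  then show "\<exists>d>0. \<forall>x'\<in>UNIV. dist x' x < d \<longrightarrow> dist (h x') (h x) < e"
    using assms[OF dist_less_imp_agree]
    by (intro exI[of _ "1 / 2 ^ m"] conjI ballI impI) simp_all
qed

lemma obtain_depends_on:
  fixes h :: "binseq \<Rightarrow> real"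
  assumes "\<And>v w. agree m v w \<Longrightarrow> h v = h w"
  obtains g where "depends_on m g" "\<And>w. apply_bcontfun g w = h w"
proof
  have h: "h \<in> bcontfun"
    using depends_on_continuous[OF assms] by (rule continuous_imp_bcontfun_binseq)
  then show "apply_bcontfun (Bcontfun h) w = h w" for w
    by (simp add: Bcontfun_inverse)
  with assms show "depends_on m (Bcontfun h)"
    by (simp add: depends_on_def)
qed

text \<open>By uniform continuity on the compact space, evaluating \<open>f\<close> at the sequence
  cut off to zeros after m coordinates moves its value by at most e/2.\<close>

lemma exists_depends_on_close:
  assumes "e > 0"
  obtains m g where "depends_on m g" "dist g f < e"
proof -
  have "uniformly_continuous_on UNIV (apply_bcontfun f)"
    using compact_UNIV_binseq by (intro compact_uniformly_continuous) auto
  then obtain d where d: "d > 0" "\<And>x y. dist x y < d \<Longrightarrow> dist (apply_bcontfun f x) (apply_bcontfun f y) < e / 2"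
    using assms unfolding uniformly_continuous_on_def by (metis UNIV_I half_gt_zero)
  obtain m where m: "1 / 2 ^ m < d"
    using real_arch_pow_inv[of d "1/2"] d by (auto simp: power_one_over)
  let ?t = "\<lambda>w. Binseq (\<lambda>k. k < m \<and> coord w k)"
  have "apply_bcontfun f (?t v) = apply_bcontfun f (?t w)" if "agree m v w" for v w
  proof -
    have "(\<lambda>k. k < m \<and> coord v k) = (\<lambda>k. k < m \<and> coord w k)"
      using that by (auto simp: agree_def)
    then show ?thesis by simp
  qed
  from obtain_depends_on[of m "\<lambda>w. apply_bcontfun f (?t w)", OF this]
  obtain g where g: "depends_on m g" "\<And>w. apply_bcontfun g w = apply_bcontfun f (?t w)"
    by blast
  have "dist g f \<le> e / 2"
  proof (rule dist_bound)
    fix w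
    have "dist (?t w) w \<le> 1 / 2 ^ m"
      by (rule dist_binseq_le) simp
    then show "dist (apply_bcontfun g w) (apply_bcontfun f w) \<le> e / 2"
      using d m g by (simp add: less_imp_le)
  qed
  with assms g that show ?thesis by fastforce
qed

lemma bsum_0 [simp]: "bsum f 0 w = 0"
  by (simp add: bsum_def)

lemma bsum_add: "bsum f (m + n) w = bsum f m w + bsum f n ((shift ^^ m) w)"
  unfolding bsum_def
  by (induction n) (simp_all add: shift_funpow_add)

lemma bsum_uminus: "bsum (- f) n w = - bsum f n w"
  by (simp add: bsum_def sum_negf)

lemma abs_apply_le_norm: "\<bar>apply_bcontfun f w\<bar> \<le> norm f"
  using norm_bounded[of f w] by simp

lemma abs_bsum_le: "\<bar>bsum f n w\<bar> \<le> real n * norm f"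
  using sum_norm_bound[of "{..<n}" "\<lambda>i. apply_bcontfun f ((shift ^^ i) w)" "norm f"] norm_bounded[of f]
  by (simp add: bsum_def)

lemma bsum_dist_le: "\<bar>bsum f n w - bsum g n w\<bar> \<le> real n * dist f g"
proof -
  have "\<bar>bsum f n w - bsum g n w\<bar> = \<bar>\<Sum>i<n. apply_bcontfun f ((shift ^^ i) w) - apply_bcontfun g ((shift ^^ i) w)\<bar>"
    by (simp add: bsum_def sum_subtractf)
  also have "\<dots> \<le> real n * dist f g"
    using sum_norm_bound[of "{..<n}" "\<lambda>i. apply_bcontfun f ((shift ^^ i) w) - apply_bcontfun g ((shift ^^ i) w)" "dist f g"]
      dist_bounded[of f _ g] by (simp add: dist_real_def)
  finally show ?thesis .
qed

text \<open>The summand at i reads the coordinates i, ..., i + m - 1. It can change only if this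
  window passes the end n or contains j, which leaves at most 2m indices, each contributing at most
  \<open>2 * norm g\<close>.\<close>

lemma bsum_depends_on:
  assumes g: "depends_on m g"
    and eq: "\<And>k. k < n \<Longrightarrow> k \<noteq> j \<Longrightarrow> coord v k = coord w k"
  shows "\<bar>bsum g n v - bsum g n w\<bar> \<le> 4 * real m * norm g"
proof -
  let ?d = "\<lambda>i. apply_bcontfun g ((shift ^^ i) v) - apply_bcontfun g ((shift ^^ i) w)"
  let ?B = "({n - m..<n} \<union> {Suc j - m..<Suc j}) \<inter> {..<n}"
  have zero: "?d i = 0" if "i \<in> {..<n} - ?B" for i
  proof -
    have "agree m ((shift ^^ i) v) ((shift ^^ i) w)"
      unfolding agree_def using that by (auto intro!: eq)
    with g show ?thesis by (auto simp: depends_on_def)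
  qed
  have bd: "norm (?d i) \<le> 2 * norm g" for i
    using abs_apply_le_norm[of g "(shift ^^ i) v"] abs_apply_le_norm[of g "(shift ^^ i) w"] by auto
  have "card ?B \<le> card ({n - m..<n} \<union> {Suc j - m..<Suc j})"
    by (intro card_mono) auto
  also have "\<dots> \<le> card {n - m..<n} + card {Suc j - m..<Suc j}"
    by (rule card_Un_le)
  also have "\<dots> \<le> 2 * m" by simp
  finally have card: "card ?B \<le> 2 * m" .
  have "bsum g n v - bsum g n w = (\<Sum>i<n. ?d i)"
    by (simp add: bsum_def sum_subtractf)
  also have "\<dots> = (\<Sum>i\<in>?B. ?d i)"
  proof (rule sum.mono_neutral_right)
    show "\<forall>i\<in>{..<n} - ?B. ?d i = 0" using zero by blast
  qed auto
  finally have "\<bar>bsum g n v - bsum g n w\<bar> \<le> real (card ?B) * (2 * norm g)"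
    using sum_norm_bound[of ?B ?d, OF bd] by simp
  also have "\<dots> \<le> real (2 * m) * (2 * norm g)"
    using card by (intro mult_right_mono of_nat_mono) auto
  finally show ?thesis by simp
qed

text \<open>Substitute for bounded distortion: replacing \<open>f\<close> by a close function of
  finitely many coordinates costs slope e/2 at each of the two points, and only that function
  contributes the constant.\<close>

lemma bsum_distortion:
  assumes "e > 0"
  obtains C where "C \<ge> 0" "\<And>n v w. agree n v w \<Longrightarrow> \<bar>bsum f n v - bsum f n w\<bar> \<le> e * real n + C"
proof -
  obtain m g where g: "depends_on m g" "dist g f < e / 2"
    using exists_depends_on_close[of "e/2" f] assms by auto
  show ?thesis
  proof (rule that[of "4 * real m * norm g"])
    fix n v w assume "agree n v w"
    then have "\<bar>bsum g n v - bsum g n w\<bar> \<le> 4 * real m * norm g"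
      using g by (intro bsum_depends_on) (auto simp: agree_def)
    have *: "\<bar>bsum g n x - bsum f n x\<bar> \<le> e * real n / 2" for x
      using bsum_dist_le[of g n x f] mult_left_mono[of "dist g f" "e/2" "real n"] g by (simp add: mult.commute)
    from *[of v] *[of w] \<open>\<bar>bsum g n v - bsum g n w\<bar> \<le> 4 * real m * norm g\<close>
    show "\<bar>bsum f n v - bsum f n w\<bar> \<le> e * real n + 4 * real m * norm g"
      by linarith
  qed simp
qed

text \<open>The level sets sum over 1..N while \<open>bsum\<close> sums over 0..N-1. The two differ
  by two boundary terms, which vanish after division by N.\<close>

lemma birkhoff_level_iff: "w \<in> birkhoff_level f a \<longleftrightarrow> (\<lambda>n. bsum f n w / real n) \<longlonglongrightarrow> a"
proof -
  have eq: "(\<Sum>n=1..N. apply_bcontfun f ((shift ^^ n) w))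
      = bsum f N w + (apply_bcontfun f ((shift ^^ N) w) - apply_bcontfun f w)" for N
    by (induction N) (simp_all add: bsum_def)
  have bdd: "\<bar>(apply_bcontfun f ((shift ^^ N) w) - apply_bcontfun f w) / real N\<bar> \<le> 2 * norm f / real N" for N
    using abs_apply_le_norm[of f "(shift ^^ N) w"] abs_apply_le_norm[of f w]
    by (simp add: divide_right_mono)
  have lim: "(\<lambda>N. (apply_bcontfun f ((shift ^^ N) w) - apply_bcontfun f w) / real N) \<longlonglongrightarrow> 0"
    by (rule Lim_null_comparison[OF _ lim_const_over_n[of "2 * norm f"]]) (use bdd in auto)
  have split: "(\<Sum>n=1..N. apply_bcontfun f ((shift ^^ n) w)) / real N
      = bsum f N w / real N + (apply_bcontfun f ((shift ^^ N) w) - apply_bcontfun f w) / real N" for N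
    unfolding eq by (simp add: add_divide_distrib)
  show ?thesis
    unfolding birkhoff_level_def mem_Collect_eq split
    using tendsto_add[OF _ lim, of "\<lambda>N. bsum f N w / real N" a]
      tendsto_diff[OF _ lim, of "\<lambda>N. bsum f N w / real N + (apply_bcontfun f ((shift ^^ N) w) - apply_bcontfun f w) / real N" a]
    by auto
qed

lemma birkhoff_levelI:
  assumes "\<And>e. e > 0 \<Longrightarrow> \<exists>C. \<forall>n. \<bar>bsum f n w - real n * a\<bar> \<le> e * real n + C"
  shows "w \<in> birkhoff_level f a"
  unfolding birkhoff_level_iff
proof (rule LIMSEQ_I)
  fix r :: real assume "r > 0"
  then obtain C where C: "\<And>n. \<bar>bsum f n w - real n * a\<bar> \<le> r / 2 * real n + C"
    using assms[of "r/2"] by auto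
  obtain N where N: "real N > 2 * C / r" using reals_Archimedean2 by blast
  show "\<exists>no. \<forall>n\<ge>no. norm (bsum f n w / real n - a) < r"
  proof (intro exI[of _ "Suc N"] allI impI)
    fix n assume n: "n \<ge> Suc N"
    have "2 * C / r < real n" using N n by linarith
    then have "2 * C < r * real n"
      using \<open>r > 0\<close> by (simp add: field_simps)
    then have "r / 2 * real n + C < r * real n"
      by simp
    then have "\<bar>bsum f n w - real n * a\<bar> < r * real n"
      using C[of n] by linarith
    moreover have "bsum f n w / real n - a = (bsum f n w - real n * a) / real n"
      using n by (simp add: field_simps)
    ultimately show "norm (bsum f n w / real n - a) < r"
      using n by (simp add: field_simps)
  qed
qed

section \<open>The maximal level\<close>

lemma le_alpha_max:
  assumes "birkhoff_level f a \<noteq> {}"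
  shows "a \<le> alpha_max f"
proof -
  have "bdd_above {a. birkhoff_level f a \<noteq> {}}"
    using birkhoff_level_bounded[of f] by (intro bdd_aboveI[of _ "norm f"]) (auto simp: abs_le_iff)
  with assms show ?thesis
    unfolding alpha_max_def by (intro cSup_upper) auto
qed

lemma abs_alpha_max_le: "\<bar>alpha_max f\<bar> \<le> norm f"
proof -
  obtain a where a: "birkhoff_level f a \<noteq> {}"
    using birkhoff_level_nonempty by blast
  have "alpha_max f \<le> norm f"
    unfolding alpha_max_def using a birkhoff_level_bounded[of f]
    by (intro cSup_least) (auto simp: abs_le_iff)
  then show ?thesis
    using le_alpha_max[OF a] birkhoff_level_bounded[OF a] by auto
qed

text \<open>If every block of length n had sum below n * b, cutting any orbit into such blocks would
  bound its averages along multiples of n by b, contradicting a nonempty level above b.\<close>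

lemma exists_bsum_ge:
  assumes "b < alpha_max f"
  obtains z where "bsum f n z \<ge> real n * b"
proof -
  have "\<exists>z. bsum f n z \<ge> real n * b"
  proof (rule ccontr)
    assume "\<not> ?thesis"
    then have less: "bsum f n z < real n * b" for z by (simp add: not_le)
    then have n: "n > 0" using bsum_0[of f] by (metis gr0I mult_eq_0_iff of_nat_0 order_less_irrefl)
    obtain a w where a: "b < a" and w: "w \<in> birkhoff_level f a"
      using less_cSupD[of "{a. birkhoff_level f a \<noteq> {}}" b] assms birkhoff_level_nonempty[of f]
      unfolding alpha_max_def by auto
    have "bsum f (k * n) z \<le> real k * (real n * b)" for k z
    proof (induction k arbitrary: z)
      case (Suc k)
      show ?case
        using Suc[of "(shift ^^ n) z"] less[of z]
        by (simp add: bsum_add algebra_simps)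
    qed simp
    then have le: "bsum f (k * n) w / real (k * n) \<le> b" if "k \<ge> 1" for k
      using n that by (simp add: field_simps)
    have "strict_mono (\<lambda>k. k * n)" using n by (simp add: strict_mono_def)
    from LIMSEQ_subseq_LIMSEQ[OF w[unfolded birkhoff_level_iff] this]
    have "(\<lambda>k. bsum f (k * n) w / real (k * n)) \<longlonglongrightarrow> a" by (simp add: o_def)
    then have "a \<le> b"
      by (rule LIMSEQ_le_const2) (use le in blast)
    with a show False by simp
  qed
  with that show ?thesis by blast
qed

lemma periodic_birkhoff_level:
  assumes "q > 0" "(shift ^^ q) y = y"
  shows "y \<in> birkhoff_level f (bsum f q y / real q)"
proof (rule birkhoff_levelI)
  fix e :: real assume e: "e > 0"
  let ?a = "bsum f q y / real q"
  have mult: "bsum f (k * q) y = real k * bsum f q y \<and> (shift ^^ (k * q)) y = y" for k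
    by (induction k) (use assms in \<open>simp_all add: bsum_add funpow_add algebra_simps\<close>)
  have "\<bar>bsum f n y - real n * ?a\<bar> \<le> e * real n + 2 * real q * norm f" for n
  proof -
    let ?r = "n mod q" and ?k = "n div q"
    have n: "n = ?k * q + ?r" by simp
    have "real n = real ?k * real q + real ?r"
      by (metis n of_nat_add of_nat_mult)
    then have "real n * ?a = real ?k * bsum f q y + real ?r * ?a"
      using assms by (simp add: field_simps)
    moreover have "bsum f n y = real ?k * bsum f q y + bsum f ?r y"
      using mult[of ?k] bsum_add[of f "?k * q" ?r y] by simp
    ultimately have "\<bar>bsum f n y - real n * ?a\<bar> \<le> \<bar>bsum f ?r y\<bar> + real ?r * \<bar>?a\<bar>"
      by (simp add: abs_mult abs_triangle_ineq4[THEN order_trans])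
    also have "\<bar>bsum f ?r y\<bar> \<le> real ?r * norm f"
      by (rule abs_bsum_le)
    also have "real ?r * \<bar>?a\<bar> \<le> real ?r * norm f"
      using abs_bsum_le[of f q y] assms by (intro mult_left_mono) (simp_all add: field_simps)
    also have "real ?r * norm f \<le> real q * norm f"
      using assms by (intro mult_right_mono) (simp_all add: less_imp_le)
    finally have "\<bar>bsum f n y - real n * ?a\<bar> \<le> 2 * real q * norm f"
      by (simp add: field_simps)
    moreover have "0 \<le> e * real n"
      using e by simp
    ultimately show ?thesis by linarith
  qed
  then show "\<exists>C. \<forall>n. \<bar>bsum f n y - real n * ?a\<bar> \<le> e * real n + C" by blast
qed

lemma periodic_bsum_le:
  assumes "(shift ^^ q) y = y"
  shows "bsum f q y \<le> real q * alpha_max f"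
proof (cases "q = 0")
  case False
  with periodic_birkhoff_level[of q y f] assms have "bsum f q y / real q \<le> alpha_max f"
    by (intro le_alpha_max) auto
  with False show ?thesis by (simp add: field_simps)
qed simp

section \<open>Comparison with periodic points\<close>

definition periodize :: "nat \<Rightarrow> binseq \<Rightarrow> binseq" where
  "periodize q w = Binseq (\<lambda>k. coord w (k mod q))"

lemma coord_periodize [simp]: "coord (periodize q w) k = coord w (k mod q)"
  by (simp add: periodize_def)

lemma periodize_periodic: "(shift ^^ q) (periodize q w) = periodize q w"
  by (rule binseq_eqI) simp

lemma bsum_periodize:
  assumes "depends_on m g"
  shows "\<bar>bsum g q (periodize q w) - bsum g q w\<bar> \<le> 4 * real m * norm g"
  by (rule bsum_depends_on[OF assms, of _ 0]) simp

text \<open>Repeating the first n letters of \<open>w\<close> periodically changes the sum by a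
  bounded amount, and the average over a period is itself a level, hence at most
  \<open>alpha_max g\<close>. The bound is thus uniform in \<open>w\<close> already at finite
  length.\<close>

lemma bsum_le_depends_on:
  assumes "depends_on m g"
  shows "bsum g n w \<le> real n * alpha_max g + 4 * real m * norm g"
  using bsum_periodize[OF assms, of n w] periodic_bsum_le[OF periodize_periodic, of g n w] by linarith

section \<open>Generic sets\<close>

lemma first_category_subset:
  assumes "first_category B" "A \<subseteq> B"
  shows "first_category A"
proof -
  obtain C :: "nat \<Rightarrow> 'a set" where C: "\<forall>n. nowhere_dense (C n)" "B = (\<Union>n. C n)"
    using assms(1) unfolding first_category_def by blast
  have "nowhere_dense (C n \<inter> A)" for n
    using C(1) interior_mono[OF closure_mono[of "C n \<inter> A" "C n"]] by (auto simp: nowhere_dense_def)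
  moreover have "A = (\<Union>n. C n \<inter> A)"
    using assms C by auto
  ultimately show ?thesis
    unfolding first_category_def by (intro exI[of _ "\<lambda>n. C n \<inter> A"]) blast
qed

lemma nowhere_dense_complI:
  fixes P :: "'a::metric_space \<Rightarrow> bool"
  assumes "\<And>f e. e > 0 \<Longrightarrow> \<exists>h d. d > 0 \<and> dist h f < e \<and> (\<forall>u. dist u h < d \<longrightarrow> P u)"
  shows "nowhere_dense (- {f. P f})"
  unfolding nowhere_dense_def
proof (rule ccontr)
  assume "interior (closure (- {f. P f})) \<noteq> {}"
  then obtain f where "f \<in> interior (closure (- {f. P f}))" by blast
  then obtain e where e: "e > 0" "ball f e \<subseteq> closure (- {f. P f})"
    by (meson mem_interior)
  obtain h d where h: "d > 0" "dist h f < e" "\<And>u. dist u h < d \<Longrightarrow> P u"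
    using assms[OF e(1)] by blast
  have "h \<in> closure (- {f. P f})"
    using e(2) h(2) by (auto simp: dist_commute)
  then obtain u where "u \<notin> {f. P f}" "dist u h < d"
    using h(1) unfolding closure_approachable by blast
  with h(3) show False by blast
qed

text \<open>A dense interior, rather than an open dense set, is asked for because the conditions on
  spectra used later are only shown to hold on balls, not to be open. The complement is then nowhere
  dense.\<close>

definition dense_interior :: "('a::metric_space \<Rightarrow> bool) \<Rightarrow> bool" where
  "dense_interior P \<longleftrightarrow> (\<forall>f e. e > 0 \<longrightarrow> (\<exists>h d. d > 0 \<and> dist h f < e \<and> (\<forall>u. dist u h < d \<longrightarrow> P u)))"

lemma dense_interior_conj:
  assumes "dense_interior P" "dense_interior Q"
  shows "dense_interior (\<lambda>f. P f \<and> Q f)"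
  unfolding dense_interior_def
proof (intro allI impI)
  fix f :: 'a and e :: real assume "e > 0"
  then obtain h d where h: "d > 0" "dist h f < e / 2" "\<And>u. dist u h < d \<Longrightarrow> P u"
    using assms(1) unfolding dense_interior_def by (meson half_gt_zero)
  have "min (e / 2) (d / 2) > 0" using \<open>e > 0\<close> h by simp
  then obtain h' d' where h': "d' > 0" "dist h' h < min (e / 2) (d / 2)" "\<And>u. dist u h' < d' \<Longrightarrow> Q u"
    using assms(2) unfolding dense_interior_def by meson
  have "dist h' f < e"
    using dist_triangle[of h' f h] h h' by simp
  moreover have "P u \<and> Q u" if "dist u h' < min d' (d / 2)" for u
    using that h(3)[of u] h' dist_triangle[of u h h'] by simp
  moreover have "min d' (d / 2) > 0" using h h' by simp
  ultimately show "\<exists>h d. d > 0 \<and> dist h f < e \<and> (\<forall>u. dist u h < d \<longrightarrow> P u \<and> Q u)" by blast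
qed

lemma dense_interior_uminus:
  fixes P :: "'a::real_normed_vector \<Rightarrow> bool"
  assumes "dense_interior P"
  shows "dense_interior (\<lambda>f. P (- f))"
  unfolding dense_interior_def
proof (intro allI impI)
  fix f :: 'a and e :: real assume "e > 0"
  then obtain h d where h: "d > 0" "dist h (- f) < e" "\<And>u. dist u h < d \<Longrightarrow> P u"
    using assms unfolding dense_interior_def by meson
  have "dist (- h) f < e" using h(2) dist_minus[of h "- f"] by simp
  moreover have "P (- u)" if "dist u (- h) < d" for u
    using that h(3)[of "- u"] dist_minus[of u "- h"] by simp
  ultimately show "\<exists>h d. d > 0 \<and> dist h f < e \<and> (\<forall>u. dist u h < d \<longrightarrow> P (- u))"
    using h(1) by blast
qed

text \<open>Functions of finitely many coordinates are dense, so a good ball has to be constructed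
  only near each of these.\<close>

lemma dense_interior_binseqI:
  fixes P :: "(binseq \<Rightarrow>\<^sub>C real) \<Rightarrow> bool"
  assumes "\<And>m g e. depends_on m g \<Longrightarrow> e > 0 \<Longrightarrow>
      \<exists>h d. d > 0 \<and> dist h g < e \<and> (\<forall>u. dist u h < d \<longrightarrow> P u)"
  shows "dense_interior P"
  unfolding dense_interior_def
proof (intro allI impI)
  fix f :: "binseq \<Rightarrow>\<^sub>C real" and e :: real assume e: "e > 0"
  then obtain m g where g: "depends_on m g" "dist g f < e / 2"
    using exists_depends_on_close[of "e / 2" f] by auto
  obtain h d where h: "d > 0" "dist h g < e / 2" "\<forall>u. dist u h < d \<longrightarrow> P u"
    using assms[OF g(1), of "e / 2"] e by auto
  have "dist h f < e"
    using dist_triangle[of h f g] g h by simp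
  with h show "\<exists>h d. d > 0 \<and> dist h f < e \<and> (\<forall>u. dist u h < d \<longrightarrow> P u)" by blast
qed

lemma genericI:
  fixes P :: "nat \<Rightarrow> 'a::metric_space \<Rightarrow> bool"
  assumes "\<And>k. dense_interior (P k)" and imp: "\<And>f. (\<And>k. P k f) \<Longrightarrow> Q f"
  shows "generic Q"
proof -
  have "nowhere_dense (- {f. P k f})" for k
    using assms(1)[of k] by (intro nowhere_dense_complI) (auto simp: dense_interior_def)
  then have "first_category (\<Union>k. - {f. P k f})"
    unfolding first_category_def by (intro exI[of _ "\<lambda>k. - {f. P k f}"]) blast
  then show ?thesis
    unfolding generic_def by (rule first_category_subset) (use imp in blast)
qed

section \<open>Bounds for the Hausdorff dimension\<close>

definition prefix_of :: "nat \<Rightarrow> binseq \<Rightarrow> bool list" where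
  "prefix_of n w = map (coord w) [0..<n]"

lemma length_prefix_of [simp]: "length (prefix_of n w) = n"
  by (simp add: prefix_of_def)

lemma nth_prefix_of [simp]: "k < n \<Longrightarrow> prefix_of n w ! k = coord w k"
  by (simp add: prefix_of_def)

lemma prefix_of_eq_iff: "prefix_of n v = prefix_of n w \<longleftrightarrow> agree n v w"
  by (auto simp: agree_def list_eq_iff_nth_eq)

lemma bounded_binseq: "bounded (A :: binseq set)"
  using compact_imp_bounded[OF compact_UNIV_binseq] by (rule bounded_subset) simp

lemma diameter_cylinder_le: "diameter {w. prefix_of n w = xs} \<le> 1 / 2 ^ n"
proof (cases "{w. prefix_of n w = xs} = {}")
  case False
  have "dist v w \<le> 1 / 2 ^ n" if "prefix_of n v = xs" "prefix_of n w = xs" for v w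
    using that by (intro dist_binseq_le) (metis agree_def prefix_of_eq_iff)
  with False show ?thesis
    unfolding diameter_def by (auto intro!: cSUP_least)
qed (simp add: diameter_def)

text \<open>The cylinders of all words in \<open>F n\<close> with n \<ge> N cover A for every N,
  since the length from which a point is captured may depend on the point. At length n they
  contribute at most c * (b / 2 powr s)^n, and the tail of this geometric series tends to 0.\<close>

lemma hausdorff_measure_eq_0I:
  assumes s: "s > 0"
    and F: "\<And>n. F n \<subseteq> {xs. length xs = n}"
    and ev: "\<And>w. w \<in> A \<Longrightarrow> \<forall>\<^sub>F n in sequentially. prefix_of n w \<in> F n"
    and card: "\<And>n. real (card (F n)) \<le> c * b ^ n"
    and b: "0 \<le> b" "b < 2 powr s" and c: "0 \<le> c"
  shows "hausdorff_measure s A = 0"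
proof -
  have fin: "finite (F n)" for n
    using finite_subset[OF F] finite_lists_length_eq[of "UNIV :: bool set" n] by simp
  define en where "en n = from_nat_into (F n)" for n
  have en: "bij_betw (en n) {..<card (F n)} (F n)" for n
    unfolding en_def by (rule bij_betw_from_nat_into_finite[OF fin])
  define r where "r = b / 2 powr s"
  have r: "0 \<le> r" "r < 1" using b by (auto simp: r_def)
  \<comment> \<open>Pairs (length, index of a word) are later flattened by
    \<open>prod_decode\<close>, because covers are indexed by naturals. The empty sets used as
    padding have diameter 0 and contribute \<open>0 powr s = 0\<close>.\<close>
  define V where "V N = (\<lambda>(n, i). if n \<ge> N \<and> i < card (F n) then {w. prefix_of n w = en n i} else {})" for N
  have small: "hausdorff_premeasure s \<delta> A \<le> ennreal (c * (r ^ N / (1 - r)))" if N: "1 / 2 ^ N \<le> \<delta>" for \<delta> N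
  proof -
    have diam: "diameter (V N (n, i)) \<le> (if n \<ge> N \<and> i < card (F n) then 1 / 2 ^ n else 0)" for n i
      using diameter_cylinder_le[of n "en n i"] by (simp add: V_def)
    have diam': "diameter (V N (n, i)) \<le> 1 / 2 ^ n" for n i
      using diam[of n i] by (rule order_trans) auto
    have cover: "A \<subseteq> (\<Union>k. V N (prod_decode k))"
    proof
      fix w assume "w \<in> A"
      then obtain n where n: "n \<ge> N" "prefix_of n w \<in> F n"
        using ev[of w] unfolding eventually_sequentially by (metis nat_le_linear)
      then obtain i where i: "i < card (F n)" "en n i = prefix_of n w"
        using en[of n] by (metis bij_betw_imp_surj_on imageE lessThan_iff)
      then have "w \<in> V N (prod_decode (prod_encode (n, i)))"
        using n by (simp add: V_def)
      then show "w \<in> (\<Union>k. V N (prod_decode k))" by blast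
    qed
    have diam_le: "diameter (V N (prod_decode k)) \<le> \<delta>" for k
    proof -
      obtain n i where k: "prod_decode k = (n, i)" by fastforce
      have "diameter (V N (n, i)) \<le> 1 / 2 ^ N"
        using diam[of n i] by (rule order_trans) (auto simp: field_simps intro: power_increasing)
      with N k show ?thesis by simp
    qed
    have "hausdorff_premeasure s \<delta> A \<le> (\<Sum>k. ennreal (diameter (V N (prod_decode k)) powr s))"
      unfolding hausdorff_premeasure_def
      by (rule INF_lower) (use cover diam_le bounded_binseq in auto)
    also have "\<dots> = (\<Sum>n. \<Sum>i. ennreal (diameter (V N (n, i)) powr s))"
      by (rule suminf_ennreal_2dimen) simp
    also have "\<dots> \<le> (\<Sum>n. ennreal (if n \<ge> N then c * r ^ n else 0))"
    proof (rule suminf_le)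
      fix n
      show "(\<Sum>i. ennreal (diameter (V N (n, i)) powr s)) \<le> ennreal (if n \<ge> N then c * r ^ n else 0)"
      proof (cases "n \<ge> N")
        case True
        have "(\<Sum>i. ennreal (diameter (V N (n, i)) powr s)) = (\<Sum>i<card (F n). ennreal (diameter (V N (n, i)) powr s))"
          by (rule suminf_finite) (auto simp: V_def)
        also have "\<dots> \<le> (\<Sum>i<card (F n). ennreal ((1 / 2 ^ n) powr s))"
          using diam[of n] s bounded_binseq True
          by (intro sum_mono ennreal_leI powr_mono2 diameter_ge_0) (simp_all add: diam')
        also have "\<dots> = ennreal (card (F n) * (1 / 2 ^ n) powr s)"
          by (simp add: ennreal_mult ennreal_of_nat_eq_real_of_nat)
        also have "\<dots> \<le> ennreal (c * b ^ n * (1 / 2 ^ n) powr s)"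
          using card by (intro ennreal_leI mult_right_mono) auto
        also have "(1 / 2 ^ n) powr s = 1 / (2 powr s) ^ n"
          by (simp add: powr_divide powr_realpow[symmetric] powr_powr mult.commute)
        finally show ?thesis using True by (simp add: r_def power_divide)
      next
        case False
        then have "V N (n, i) = {}" for i by (simp add: V_def)
        with False show ?thesis by simp
      qed
    qed auto
    also have "\<dots> = ennreal (\<Sum>n. if n \<ge> N then c * r ^ n else 0)"
      by (rule suminf_ennreal2) (use r c in \<open>auto intro!: summable_comparison_test'[of "\<lambda>n. c * r ^ n" 0] summable_mult summable_geometric\<close>)
    also have "(\<Sum>n. if n \<ge> N then c * r ^ n else 0) = (\<Sum>n. c * r ^ N * r ^ n)"
    proof -
      have "summable (\<lambda>n. if n \<ge> N then c * r ^ n else 0)"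
        using r c by (auto intro!: summable_comparison_test'[of "\<lambda>n. c * r ^ n" 0] summable_mult summable_geometric)
      from suminf_split_initial_segment[OF this, of N] show ?thesis
        by (simp add: power_add mult_ac)
    qed
    also have "\<dots> = c * (r ^ N / (1 - r))"
      using r by (subst suminf_mult) (auto simp: suminf_geometric intro!: summable_geometric)
    finally show ?thesis .
  qed
  have "hausdorff_premeasure s \<delta> A = 0" if "\<delta> > 0" for \<delta>
  proof -
    have ev: "\<forall>\<^sub>F N in sequentially. 1 / 2 ^ N \<le> \<delta>"
      using order_tendstoD(2)[OF LIMSEQ_power_zero[of "1/2::real"] \<open>\<delta> > 0\<close>]
      by (rule eventually_mono) (simp_all add: power_one_over)
    have "(\<lambda>N. c * (r ^ N / (1 - r))) \<longlonglongrightarrow> c * (0 / (1 - r))"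
      using r by (intro tendsto_intros LIMSEQ_power_zero) auto
    then have "(\<lambda>N. ennreal (c * (r ^ N / (1 - r)))) \<longlonglongrightarrow> ennreal 0"
      by (intro tendsto_ennrealI) simp
    then have "hausdorff_premeasure s \<delta> A \<le> ennreal 0"
      by (rule tendsto_lowerbound[OF _ eventually_mono[OF ev small]]) simp_all
    then show ?thesis by simp
  qed
  then show ?thesis
    unfolding hausdorff_measure_def by (auto intro!: antisym SUP_least)
qed

text \<open>Under the product of uniform measures on W, the points of V i with all letters in W lie
  in one cylinder of length k i, which has measure (1 / card W)^(k i). The cover has total mass at
  least 1.\<close>

lemma one_le_sum_cylinders:
  fixes W :: "'a set"
  assumes W: "finite W" "W \<noteq> {}"
    and cover: "\<And>x. (\<And>k. x k \<in> W) \<Longrightarrow> \<exists>i::nat. x \<in> V i"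
    and agree: "\<And>i x y j. x \<in> V i \<Longrightarrow> y \<in> V i \<Longrightarrow> j < k i \<Longrightarrow> x j = y j"
  shows "1 \<le> (\<Sum>i. ennreal ((1 / real (card W)) ^ k i))"
proof -
  let ?P = "uniform_count_measure W"
  interpret product_prob_space "\<lambda>_::nat. ?P" UNIV
    by (rule product_prob_spaceI) (rule prob_space_uniform_count_measure[OF W])
  let ?M = "PiM (UNIV :: nat set) (\<lambda>_. ?P)"
  \<comment> \<open>V i may fail to be measurable, so it is replaced by the cylinder through one
    chosen point of it.\<close>
  define B where "B i = (if \<exists>x. x \<in> V i \<and> (\<forall>k. x k \<in> W)
      then prod_emb UNIV (\<lambda>_. ?P) {..<k i} (PiE {..<k i} (\<lambda>j. {(SOME x. x \<in> V i \<and> (\<forall>k. x k \<in> W)) j}))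
      else {})" for i
  have B: "B i \<in> sets ?M \<and> emeasure ?M (B i) \<le> ennreal ((1 / real (card W)) ^ k i)" for i
  proof (cases "\<exists>x. x \<in> V i \<and> (\<forall>k. x k \<in> W)")
    case True
    define x where "x = (SOME x. x \<in> V i \<and> (\<forall>k. x k \<in> W))"
    have x: "x \<in> V i \<and> (\<forall>k. x k \<in> W)"
      unfolding x_def using True by (rule someI_ex)
    have eq: "B i = prod_emb UNIV (\<lambda>_. ?P) {..<k i} (PiE {..<k i} (\<lambda>j. {x j}))"
      using True by (simp add: B_def x_def)
    have sets: "{x j} \<in> sets ?P" for j
      using x by (simp add: sets_uniform_count_measure)
    have "emeasure ?M (B i) = (\<Prod>j<k i. emeasure ?P {x j})"
      unfolding eq using sets by (subst emeasure_PiM_emb) auto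
    also have "\<dots> = (\<Prod>j<k i. ennreal (1 / real (card W)))"
      using x W by (intro prod.cong) (auto simp: emeasure_uniform_count_measure)
    also have "\<dots> = ennreal ((1 / real (card W)) ^ k i)"
      by (simp add: ennreal_power)
    finally show ?thesis
      using sets unfolding eq by (auto intro!: sets_PiM_I)
  next
    case False
    then have "B i = {}" by (simp only: B_def if_False)
    then show ?thesis by simp
  qed
  have "space ?M \<subseteq> (\<Union>i. B i)"
  proof
    fix y assume "y \<in> space ?M"
    then have y: "y k \<in> W" for k
      by (auto simp: space_PiM space_uniform_count_measure)
    then obtain i where i: "y \<in> V i" using cover by blast
    let ?x = "SOME x. x \<in> V i \<and> (\<forall>k. x k \<in> W)"
    have ex: "\<exists>x. x \<in> V i \<and> (\<forall>k. x k \<in> W)" using i y by blast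
    then have "?x \<in> V i" by (rule someI2_ex) blast
    then have "y j = ?x j" if "j < k i" for j
      using agree i that by blast
    then have "y \<in> B i"
      using ex y by (auto simp: B_def prod_emb_def space_uniform_count_measure restrict_def PiE_iff extensional_def)
    then show "y \<in> (\<Union>i. B i)" by blast
  qed
  then have "emeasure ?M (space ?M) \<le> emeasure ?M (\<Union>i. B i)"
    using B by (intro emeasure_mono) auto
  also have "\<dots> \<le> (\<Sum>i. emeasure ?M (B i))"
    using B by (intro emeasure_subadditive_countably) auto
  also have "\<dots> \<le> (\<Sum>i. ennreal ((1 / real (card W)) ^ k i))"
    using B by (intro suminf_le) auto
  finally show ?thesis
    by (simp add: emeasure_space_1)
qed

text \<open>Mass distribution principle for a set coded by free letters from W: every R coordinates
  of the image determine one more letter, so a set of diameter below 2^(-k R) meets the image only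
  inside a cylinder of k letters.\<close>

lemma hausdorff_dim_ge:
  fixes W :: "'a set" and \<Phi> :: "(nat \<Rightarrow> 'a) \<Rightarrow> binseq"
  assumes W: "finite W" "W \<noteq> {}" and R: "R > 0"
    and E: "\<And>x. (\<And>k. x k \<in> W) \<Longrightarrow> \<Phi> x \<in> E"
    and sep: "\<And>x y n j. (\<And>k. x k \<in> W) \<Longrightarrow> (\<And>k. y k \<in> W) \<Longrightarrow> agree (n * R) (\<Phi> x) (\<Phi> y) \<Longrightarrow> j < n \<Longrightarrow> x j = y j"
  shows "ereal (log 2 (card W) / R) \<le> hausdorff_dim E"
  unfolding hausdorff_dim_def
proof (rule INF_greatest, unfold mem_Collect_eq ereal_less_eq, rule ccontr)
  fix s :: real assume s: "0 < s \<and> hausdorff_measure s E = 0" and "\<not> log 2 (card W) / R \<le> s"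
  define K where "K = real (card W)"
  define D where "D = log 2 K / real R"
  have D: "s < D" using \<open>\<not> _ \<le> s\<close> by (simp add: D_def K_def)
  have K0: "K > 0" using W by (simp add: K_def card_gt_0_iff)
  have K_eq: "K = 2 powr (real R * D)" using R K0 by (simp add: D_def)
  have K1: "K > 1"
    unfolding K_eq using D s R by (intro gr_one_powr) auto
  \<comment> \<open>Any scale below 1 would do: it guarantees that a set of the cover fits the
    trivial cylinder k = 0.\<close>
  have "hausdorff_premeasure s (1 / 2) E \<le> hausdorff_measure s E"
    unfolding hausdorff_measure_def by (rule SUP_upper) simp
  then have "hausdorff_premeasure s (1 / 2) E < ennreal (1 / (4 * K))"
    using s K0 by simp
  then obtain U :: "nat \<Rightarrow> binseq set" where U: "E \<subseteq> (\<Union>i. U i)" "\<And>i. bounded (U i)" "\<And>i. diameter (U i) \<le> 1 / 2"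
    and sum: "(\<Sum>i. ennreal (diameter (U i) powr s)) < ennreal (1 / (4 * K))"
    unfolding hausdorff_premeasure_def INF_less_iff by blast
  \<comment> \<open>The factor K pays for the one letter between 2^(-(k+1) R) and 2^(-k R). The
    summable extra term is for sets of diameter 0, which contribute nothing to the premeasure but
    still need a finite k. Summed up, both parts are at most 1/4, hence less than 1
    together.\<close>
  have "\<exists>k. (1 / K) ^ k \<le> K * diameter (U i) powr s + 1 / 4 * (1 / 2) ^ Suc i \<and>
      (\<forall>v\<in>U i. \<forall>w\<in>U i. agree (k * R) v w)" for i
  proof (cases "diameter (U i) = 0")
    case True
    obtain k where "(1 / K) ^ k < 1 / 4 * (1 / 2) ^ Suc i"
      using real_arch_pow_inv[of "1 / 4 * (1 / 2) ^ Suc i" "1 / K"] K1 by auto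
    moreover have "v = w" if "v \<in> U i" "w \<in> U i" for v w
      using diameter_bounded_bound[OF U(2) that] True by simp
    ultimately show ?thesis
      using True by (intro exI[of _ k]) (auto simp: agree_def less_imp_le)
  next
    case False
    define d where "d = diameter (U i)"
    have d: "d > 0" using False diameter_ge_0[OF U(2)] by (simp add: d_def less_le)
    let ?b = "1 / 2 ^ R :: real"
    have b: "?b < 1" using R by (simp add: one_less_power)
    obtain n where "?b ^ n < d"
      using real_arch_pow_inv[OF d b] by blast
    moreover have "?b ^ Suc n \<le> ?b ^ n"
      using b by (intro power_decreasing) auto
    ultimately have "?b ^ Suc n \<le> d" by linarith
    then have ex: "\<exists>n. ?b ^ Suc n \<le> d" by blast
    define k where "k = (LEAST n. ?b ^ Suc n \<le> d)"
    have k: "?b ^ Suc k \<le> d" unfolding k_def by (rule LeastI_ex[OF ex])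
    have less: "d < ?b ^ k"
    proof (cases k)
      case 0
      then show ?thesis using U(3)[of i] by (simp add: d_def)
    next
      case (Suc n)
      then have "\<not> ?b ^ Suc n \<le> d"
        using not_less_Least[of n "\<lambda>n. ?b ^ Suc n \<le> d"] by (simp add: k_def)
      with Suc show ?thesis by simp
    qed
    have "agree (k * R) v w" if "v \<in> U i" "w \<in> U i" for v w
    proof (rule dist_less_imp_agree)
      show "dist v w < 1 / 2 ^ (k * R)"
        using diameter_bounded_bound[OF U(2) that] less
        by (simp add: d_def power_one_over power_mult[symmetric] mult.commute)
    qed
    moreover have "(1 / K) ^ k \<le> K * d powr s"
    proof -
      have "(1 / K) ^ k = K * (1 / K) ^ Suc k" using K0 by simp
      also have "(1 / K) ^ Suc k = 2 powr (- (real R * D * real (Suc k)))"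
        unfolding K_eq powr_minus_divide[symmetric]
        by (simp add: powr_realpow[symmetric] powr_powr del: of_nat_Suc power_Suc)
      also have "\<dots> \<le> 2 powr (- (real R * s * real (Suc k)))"
        using D by (intro powr_mono) (simp_all add: mult_left_mono mult_right_mono)
      also have "\<dots> = (?b ^ Suc k) powr s"
      proof -
        have "?b ^ Suc k = 2 powr (- (real R * real (Suc k)))"
          by (simp add: powr_minus_divide power_one_over power_mult[symmetric] powr_realpow[symmetric]
              del: power_Suc of_nat_Suc)
            (simp add: powr_powr del: of_nat_Suc)
        then show ?thesis by (simp add: powr_powr mult_ac del: of_nat_Suc power_Suc)
      qed
      also have "\<dots> \<le> d powr s"
        using k s by (intro powr_mono2) auto
      finally show ?thesis using K0 by simp
    qed
    moreover have "0 \<le> 1 / 4 * (1 / 2 :: real) ^ Suc i" by simp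
    ultimately have "(1 / K) ^ k \<le> K * diameter (U i) powr s + 1 / 4 * (1 / 2) ^ Suc i"
      unfolding d_def by linarith
    then show ?thesis
      using \<open>\<And>w v. v \<in> U i \<Longrightarrow> w \<in> U i \<Longrightarrow> agree (k * R) v w\<close> by blast
  qed
  then have "\<forall>i. \<exists>k. (1 / K) ^ k \<le> K * diameter (U i) powr s + 1 / 4 * (1 / 2) ^ Suc i \<and>
      (\<forall>v\<in>U i. \<forall>w\<in>U i. agree (k * R) v w)" ..
  from choice[OF this] obtain k where k: "\<And>i. (1 / K) ^ k i \<le> K * diameter (U i) powr s + 1 / 4 * (1 / 2) ^ Suc i"
    and agr: "\<And>i v w. v \<in> U i \<Longrightarrow> w \<in> U i \<Longrightarrow> agree (k i * R) v w"
    by blast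
  have "1 \<le> (\<Sum>i. ennreal ((1 / real (card W)) ^ k i))"
  proof (rule one_le_sum_cylinders[OF W, where V = "\<lambda>i. {x. (\<forall>k. x k \<in> W) \<and> \<Phi> x \<in> U i}"])
    fix x :: "nat \<Rightarrow> 'a" assume x: "\<And>k. x k \<in> W"
    then have "\<Phi> x \<in> E" by (rule E)
    with U(1) x show "\<exists>i. x \<in> {x. (\<forall>k. x k \<in> W) \<and> \<Phi> x \<in> U i}" by blast
  next
    fix i j and x y :: "nat \<Rightarrow> 'a"
    assume "x \<in> {x. (\<forall>k. x k \<in> W) \<and> \<Phi> x \<in> U i}" "y \<in> {x. (\<forall>k. x k \<in> W) \<and> \<Phi> x \<in> U i}" "j < k i"
    then show "x j = y j"
      using agr[of "\<Phi> x" i "\<Phi> y"] by (intro sep[of x y "k i"]) auto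
  qed
  also have "\<dots> \<le> (\<Sum>i. ennreal K * ennreal (diameter (U i) powr s) + ennreal (1 / 4 * (1 / 2) ^ Suc i))"
  proof (rule suminf_le)
    fix i
    have "ennreal ((1 / K) ^ k i) \<le> ennreal (K * diameter (U i) powr s + 1 / 4 * (1 / 2) ^ Suc i)"
      by (rule ennreal_leI[OF k])
    also have "\<dots> = ennreal K * ennreal (diameter (U i) powr s) + ennreal (1 / 4 * (1 / 2) ^ Suc i)"
      using K0 by (subst ennreal_plus) (simp_all add: ennreal_mult)
    finally show "ennreal ((1 / real (card W)) ^ k i)
      \<le> ennreal K * ennreal (diameter (U i) powr s) + ennreal (1 / 4 * (1 / 2) ^ Suc i)"
      by (simp add: K_def)
  qed auto
  also have "\<dots> = ennreal K * (\<Sum>i. ennreal (diameter (U i) powr s)) + (\<Sum>i. ennreal (1 / 4 * (1 / 2) ^ Suc i))"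
    by (subst suminf_add[symmetric]) auto
  also have "(\<Sum>i. ennreal (1 / 4 * (1 / 2) ^ Suc i)) = ennreal (1 / 4)"
    using sums_mult[OF power_half_series, of "1 / 4"]
    by (intro suminf_ennreal_eq) auto
  also have "ennreal K * (\<Sum>i. ennreal (diameter (U i) powr s)) + ennreal (1 / 4)
      \<le> ennreal K * ennreal (1 / (4 * K)) + ennreal (1 / 4)"
    using sum by (intro add_right_mono mult_left_mono) auto
  also have "\<dots> = ennreal (1 / 2)"
    using K0 by (simp add: ennreal_mult[symmetric] ennreal_plus[symmetric] del: ennreal_plus)
  finally have "ennreal 1 \<le> ennreal (1 / 2)"
    unfolding ennreal_1 .
  then have "(1 :: real) \<le> 1 / 2"
    by (subst (asm) ennreal_le_iff) auto
  then show False by simp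
qed

section \<open>Dimension zero at the maximal level\<close>

definition mismatches :: "nat \<Rightarrow> bool list \<Rightarrow> nat" where
  "mismatches q xs = card {i. i + q < length xs \<and> xs ! i \<noteq> xs ! (i + q)}"

lemma mismatches_Cons:
  assumes "q > 0"
  shows "mismatches q (x # ys) = of_bool (q \<le> length ys \<and> x \<noteq> ys ! (q - 1)) + mismatches q ys"
proof -
  let ?S = "{i. i + q < length ys \<and> ys ! i \<noteq> ys ! (i + q)}"
  let ?T = "{i. i + q < length (x # ys) \<and> (x # ys) ! i \<noteq> (x # ys) ! (i + q)}"
  have iff: "i \<in> ?T \<longleftrightarrow> i = 0 \<and> q \<le> length ys \<and> x \<noteq> ys ! (q - 1) \<or> i \<in> Suc ` ?S" for i
    using assms by (cases i) (auto simp: nth_Cons')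
  have fin: "finite (Suc ` ?S)"
    by (rule finite_imageI, rule finite_subset[of _ "{..<length ys}"]) auto
  have card: "card (Suc ` ?S) = mismatches q ys"
    by (simp add: mismatches_def card_image)
  show ?thesis
  proof (cases "q \<le> length ys \<and> x \<noteq> ys ! (q - 1)")
    case True
    then have "?T = insert 0 (Suc ` ?S)"
      using iff by blast
    then have "mismatches q (x # ys) = card (insert 0 (Suc ` ?S))"
      by (simp only: mismatches_def)
    with fin card True show ?thesis by (simp add: card_insert_if)
  next
    case False
    then have "?T = Suc ` ?S"
      using iff by blast
    then have "mismatches q (x # ys) = card (Suc ` ?S)"
      by (simp only: mismatches_def)
    with card False show ?thesis by simp
  qed
qed

text \<open>Build words from the right. A prepended letter either equals the one q places later
  (weight 1) or not (weight \<open>\<theta>\<close>), a factor 1 + \<theta>; while there is no such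
  later letter, both choices have weight 1, a factor 2.\<close>

lemma sum_power_mismatches_le:
  fixes \<theta> :: real
  assumes "q > 0" "0 \<le> \<theta>"
  shows "(\<Sum>xs | length xs = n. \<theta> ^ mismatches q xs) \<le> 2 ^ min q n * (1 + \<theta>) ^ n"
proof (induction n)
  case 0
  have "{xs :: bool list. length xs = 0} = {[]}" by auto
  then show ?case by (simp add: mismatches_def)
next
  case (Suc n)
  let ?L = "{xs :: bool list. length xs = n}"
  have fin: "finite ?L"
    using finite_lists_length_eq[of "UNIV :: bool set" n] by simp
  have eq: "{xs :: bool list. length xs = Suc n} = (#) True ` ?L \<union> (#) False ` ?L"
    by (auto simp: length_Suc_conv image_iff)
  let ?c = "if q \<le> n then 1 + \<theta> else 2"
  have "(\<Sum>xs | length xs = Suc n. \<theta> ^ mismatches q xs)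
      = (\<Sum>xs\<in>?L. \<theta> ^ mismatches q (True # xs)) + (\<Sum>xs\<in>?L. \<theta> ^ mismatches q (False # xs))"
    unfolding eq using fin by (subst sum.union_disjoint) (auto simp: sum.reindex)
  also have "\<dots> = (\<Sum>xs\<in>?L. ?c * \<theta> ^ mismatches q xs)"
    unfolding sum.distrib[symmetric]
    by (rule sum.cong) (auto simp: mismatches_Cons[OF assms(1)] algebra_simps)
  also have "\<dots> = ?c * (\<Sum>xs\<in>?L. \<theta> ^ mismatches q xs)"
    by (rule sum_distrib_left[symmetric])
  also have "\<dots> \<le> ?c * (2 ^ min q n * (1 + \<theta>) ^ n)"
    using assms Suc by (intro mult_left_mono) auto
  also have "\<dots> \<le> 2 ^ min q (Suc n) * (1 + \<theta>) ^ Suc n"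
  proof (cases "q \<le> n")
    case True
    then show ?thesis by (simp add: min_def)
  next
    case False
    then have "2 ^ min q n * (1 + \<theta>) ^ n \<le> 2 ^ min q n * (1 + \<theta>) ^ Suc n"
      using assms by (intro mult_left_mono power_increasing) auto
    with False show ?thesis by (simp add: min_absorb2 not_le Suc_leI)
  qed
  finally show ?case .
qed

text \<open>Exponential Markov bound: every counted word contributes at least \<theta> powr
  (\<delta> * n) to the generating sum, as \<theta> \<le> 1.\<close>

lemma card_few_mismatches_le:
  fixes \<theta> \<delta> :: real
  assumes q: "q > 0" and \<theta>: "0 < \<theta>" "\<theta> \<le> 1"
  shows "real (card {xs. length xs = n \<and> real (mismatches q xs) \<le> \<delta> * real n})
    \<le> 2 ^ q * ((1 + \<theta>) * \<theta> powr (- \<delta>)) ^ n"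
proof -
  let ?F = "{xs. length xs = n \<and> real (mismatches q xs) \<le> \<delta> * real n}"
  have fin: "finite {xs :: bool list. length xs = n}"
    using finite_lists_length_eq[of "UNIV :: bool set" n] by simp
  have ge: "\<theta> powr (\<delta> * real n) \<le> \<theta> ^ mismatches q xs" if "xs \<in> ?F" for xs
    using that \<theta> powr_mono'[of "real (mismatches q xs)" "\<delta> * real n" \<theta>] by (simp add: powr_realpow)
  have "real (card ?F) * \<theta> powr (\<delta> * real n) \<le> (\<Sum>xs\<in>?F. \<theta> ^ mismatches q xs)"
    using sum_bounded_below[of ?F, OF ge] by simp
  also have "\<dots> \<le> (\<Sum>xs | length xs = n. \<theta> ^ mismatches q xs)"
    using \<theta> fin by (intro sum_mono2) auto
  also have "\<dots> \<le> 2 ^ min q n * (1 + \<theta>) ^ n"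
    using q \<theta> by (intro sum_power_mismatches_le) auto
  also have "\<dots> \<le> 2 ^ q * (1 + \<theta>) ^ n"
    using \<theta> by (intro mult_right_mono power_increasing) auto
  finally have "real (card ?F) \<le> 2 ^ q * (1 + \<theta>) ^ n * \<theta> powr (- (\<delta> * real n))"
    using \<theta> by (simp add: powr_minus field_simps)
  also have "\<theta> powr (- (\<delta> * real n)) = (\<theta> powr (- \<delta>)) ^ n"
    using \<theta> by (simp add: powr_realpow[symmetric] powr_powr)
  finally show ?thesis by (simp add: power_mult_distrib mult_ac)
qed

text \<open>The frequency \<delta> depends on s but not on q, because the factor 2^q of the word
  count is constant in n. This order of quantifiers matters: the period is later chosen after
  \<delta>.\<close>

lemma exists_mismatch_frequency:
  assumes s: "s > 0"
  shows "\<exists>\<delta>>0. \<forall>q>0. \<forall>A. (\<forall>w\<in>A. \<forall>\<^sub>F n in sequentially. real (card {i. i < n \<and> coord w i \<noteq> coord w (i + q)}) \<le> \<delta> * real n) \<longrightarrow>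
      hausdorff_measure s A = 0"
proof -
  let ?r = "2 powr (s / 2) :: real"
  \<comment> \<open>The two factors of the growth rate share the budget 2 powr s equally: 1 +
    \<theta> stays below 2 powr (s/2), and \<delta> is chosen so that \<theta> powr (-\<delta>)
    equals 2 powr (s/2).\<close>
  define \<theta> where "\<theta> = min (1 / 2) ((?r - 1) / 2)"
  have r: "?r > 1" using s by (intro gr_one_powr) auto
  have \<theta>: "0 < \<theta>" "\<theta> < 1" "1 + \<theta> < ?r"
    using r by (auto simp: \<theta>_def min_def field_simps)
  define \<delta> where "\<delta> = (s / 2) * ln 2 / (- ln \<theta>)"
  have ln: "ln \<theta> < 0" using \<theta> by simp
  have \<delta>: "\<delta> > 0" using s ln by (simp add: \<delta>_def divide_pos_neg)
  have "\<theta> powr (- \<delta>) = ?r"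
    using \<theta> ln by (simp add: \<delta>_def powr_def field_simps)
  then have less: "(1 + \<theta>) * \<theta> powr (- \<delta>) < 2 powr s"
    using \<theta> r powr_add[of 2 "s / 2" "s / 2"] by simp
  show ?thesis
  proof (intro exI[of _ \<delta>] conjI allI impI \<delta>)
    fix q and A :: "binseq set"
    assume q: "q > (0::nat)"
      and ev: "\<forall>w\<in>A. \<forall>\<^sub>F n in sequentially. real (card {i. i < n \<and> coord w i \<noteq> coord w (i + q)}) \<le> \<delta> * real n"
    show "hausdorff_measure s A = 0"
    proof (rule hausdorff_measure_eq_0I[OF s])
      fix w assume "w \<in> A"
      from bspec[OF ev this] show "\<forall>\<^sub>F n in sequentially.
          prefix_of n w \<in> {xs. length xs = n \<and> real (mismatches q xs) \<le> \<delta> * real n}"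
      proof (rule eventually_mono)
        fix n assume le: "real (card {i. i < n \<and> coord w i \<noteq> coord w (i + q)}) \<le> \<delta> * real n"
        have "mismatches q (prefix_of n w) \<le> card {i. i < n \<and> coord w i \<noteq> coord w (i + q)}"
          unfolding mismatches_def by (rule card_mono) auto
        with le show "prefix_of n w \<in> {xs. length xs = n \<and> real (mismatches q xs) \<le> \<delta> * real n}"
          by simp
      qed
    next
      show "real (card {xs. length xs = n \<and> real (mismatches q xs) \<le> \<delta> * real n})
          \<le> 2 ^ q * ((1 + \<theta>) * \<theta> powr (- \<delta>)) ^ n" for n
        using q \<theta> by (intro card_few_mismatches_le) auto
    qed (use \<theta> less in auto)
  qed
qed

text \<open>
  Rewarding \<open>q\<close>-periodic behaviour forces near-maximizing orbits to be \<open>q\<close>-periodic most of the time: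
  for large \<open>q\<close> the periodic points come within \<open>e\<^sup>2\<close> of the old maximum, which is negligible
  against the reward \<open>e\<close>.
\<close>

lemma exists_null_maximal_level:
  assumes g: "depends_on m g" and e: "e > 0" and s: "s > 0"
  shows "\<exists>h d. d > 0 \<and> dist h g < e \<and>
    (\<forall>u. dist u h < d \<longrightarrow> hausdorff_measure s (birkhoff_level u (alpha_max u)) = 0)"
proof -
  obtain \<delta> where \<delta>: "\<delta> > 0" and null: "\<forall>q>0. \<forall>A. (\<forall>w\<in>A. \<forall>\<^sub>F n in sequentially. real (card {i. i < n \<and> coord w i \<noteq> coord w (i + q)}) \<le> \<delta> * real n) \<longrightarrow>
      hausdorff_measure s A = 0"
    using exists_mismatch_frequency[OF s] by blast
  \<comment> \<open>The reward r must be small both for closeness to g and because the mismatch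
    frequency obtained at the end is 4 * r.\<close>
  define r where "r = min (e / 2) (\<delta> / 4)"
  have r: "r > 0" "r < e" "4 * r \<le> \<delta>" using e \<delta> by (auto simp: r_def)
  define c where "c = 4 * real m * norm g"
  have c: "c \<ge> 0" by (simp add: c_def)
  \<comment> \<open>Here c bounds the cost of periodizing one word; a period this long makes the
    cost per letter at most r^2.\<close>
  obtain q where q': "real q > c / r\<^sup>2" using reals_Archimedean2 by blast
  have "q > 0" using q' c r by (cases "q = 0") (auto simp: divide_less_0_iff)
  have q: "c \<le> real q * r\<^sup>2" using q' r by (simp add: field_simps)
  define \<phi> where "\<phi> w = r * of_bool (coord w 0 = coord w q)" for w
  have "\<phi> v = \<phi> w" if "agree (Suc q) v w" for v w
    using that by (simp add: agree_def \<phi>_def)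
  from obtain_depends_on[of "Suc q" \<phi>, OF this]
  obtain p where p: "\<And>w. apply_bcontfun p w = \<phi> w"
    by blast
  define h where "h = g + p"
  have "dist h g < e"
  proof -
    have "dist h g \<le> r"
      by (rule dist_bound) (use r in \<open>simp add: h_def p \<phi>_def dist_real_def\<close>)
    with r show ?thesis by simp
  qed
  have bsum_h: "bsum h n w = bsum g n w + r * (real n - real (card {i. i < n \<and> coord w i \<noteq> coord w (i + q)}))" for n w
  proof -
    have "(\<Sum>i<n. \<phi> ((shift ^^ i) w)) = r * (real n - real (card {i. i < n \<and> coord w i \<noteq> coord w (i + q)}))"
    proof -
      have "(\<Sum>i<n. \<phi> ((shift ^^ i) w)) = (\<Sum>i<n. r - r * of_bool (coord w i \<noteq> coord w (i + q)))"
        by (rule sum.cong) (auto simp: \<phi>_def add.commute)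
      also have "\<dots> = r * real n - r * (\<Sum>i<n. of_bool (coord w i \<noteq> coord w (i + q)))"
        by (simp add: sum_subtractf sum_distrib_left mult.commute)
      also have "(\<Sum>i<n. of_bool (coord w i \<noteq> coord w (i + q))) = real (card {i. i < n \<and> coord w i \<noteq> coord w (i + q)})"
        by (simp add: of_bool_def sum.If_cases Int_def)
      finally show ?thesis by (simp add: algebra_simps)
    qed
    then show ?thesis
      by (simp add: bsum_def h_def plus_bcontfun.rep_eq sum.distrib p)
  qed
  define d where "d = r\<^sup>2 / 2"
  have "hausdorff_measure s (birkhoff_level u (alpha_max u)) = 0" if u: "dist u h < d" for u
  proof (rule null[rule_format, OF \<open>q > 0\<close>])
    fix w assume w: "w \<in> birkhoff_level u (alpha_max u)"
    have uh: "\<bar>bsum u n v - bsum h n v\<bar> \<le> real n * d" for n v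
      using bsum_dist_le[of u n v h] mult_left_mono[of "dist u h" d "real n"] u by linarith
    \<comment> \<open>The periodic point earns the full reward r. It loses r^2 from the choice of z,
      at most r^2 from periodizing, and d from passing between h and u.\<close>
    have max: "alpha_max u \<ge> alpha_max g + r - 2 * r\<^sup>2 - d"
    proof -
      obtain z where z: "bsum g q z \<ge> real q * (alpha_max g - r\<^sup>2)"
        using exists_bsum_ge[of "alpha_max g - r\<^sup>2" g q] r by auto
      let ?y = "periodize q z"
      have "{i. i < q \<and> coord ?y i \<noteq> coord ?y (i + q)} = {}" by auto
      then have "bsum h q ?y = bsum g q ?y + r * real q"
        by (simp only: bsum_h) simp
      then have "real q * (alpha_max g - r\<^sup>2) - c + r * real q - real q * d \<le> real q * alpha_max u"
        using periodic_bsum_le[OF periodize_periodic, of u q z] uh[of q ?y] bsum_periodize[OF g, of q z] z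
        unfolding c_def by linarith
      with q have "real q * (alpha_max g + r - 2 * r\<^sup>2 - d) \<le> real q * alpha_max u"
        by (simp add: algebra_simps)
      with \<open>q > 0\<close> show ?thesis by simp
    qed
    have "\<forall>\<^sub>F n in sequentially. bsum u n w / real n > alpha_max u - r\<^sup>2 / 2"
      using w r unfolding birkhoff_level_iff by (intro order_tendstoD(1)) auto
    moreover have "\<forall>\<^sub>F n in sequentially. real n > 2 * c / r\<^sup>2"
      using filterlim_real_sequentially by (simp add: filterlim_at_top_dense)
    moreover have "\<forall>\<^sub>F n in sequentially. n > (0::nat)"
      by (rule eventually_gt_at_top)
    ultimately show "\<forall>\<^sub>F n in sequentially. real (card {i. i < n \<and> coord w i \<noteq> coord w (i + q)}) \<le> \<delta> * real n"
    proof eventually_elim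
      case (elim n)
      let ?B = "real (card {i. i < n \<and> coord w i \<noteq> coord w (i + q)})"
      have "real n * (alpha_max u - r\<^sup>2 / 2) \<le> bsum u n w"
        using elim by (simp add: field_simps)
      also have "\<dots> \<le> real n * alpha_max g + c + r * (real n - ?B) + real n * d"
        using uh[of n w] bsum_h[of n w] bsum_le_depends_on[OF g, of n w] unfolding c_def by linarith
      \<comment> \<open>Each mismatch forfeits r, while all errors are quadratic in r: with d = r^2
        / 2 they add up to 4 * r^2 per letter. Dividing by r gives the frequency 4 * r.\<close>
      finally have "r * ?B \<le> real n * (alpha_max g + r + d + r\<^sup>2 / 2 - alpha_max u) + c"
        by (simp add: algebra_simps)
      also have "\<dots> \<le> real n * (2 * d + 5 / 2 * r\<^sup>2) + c"
        using max by (intro add_right_mono mult_left_mono) auto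
      also have "c \<le> real n * (r\<^sup>2 / 2)"
        using elim r by (simp add: field_simps)
      finally have "r * ?B \<le> r * (4 * r * real n)"
        by (simp add: d_def power2_eq_square algebra_simps)
      then have "?B \<le> 4 * r * real n"
        using r by simp
      also have "\<dots> \<le> \<delta> * real n"
        using r by (intro mult_right_mono) auto
      finally show ?case .
    qed
  qed
  moreover have "d > 0" using r by (simp add: d_def)
  ultimately show ?thesis using \<open>dist h g < e\<close> by blast
qed

section \<open>Dimension below the maximal level\<close>

lemma prefix_of_add: "prefix_of (m + n) w = prefix_of m w @ prefix_of n ((shift ^^ m) w)"
  by (rule nth_equalityI) (auto simp: nth_append add.commute)

primrec feedback :: "(bool list \<Rightarrow> bool list) \<Rightarrow> (nat \<Rightarrow> bool list) \<Rightarrow> nat \<Rightarrow> bool list" where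
  "feedback c x 0 = []"
| "feedback c x (Suc k) = feedback c x k @ x k @ c (feedback c x k)"

text \<open>After n + 1 nonempty blocks the position n is already written, and later blocks never
  change it.\<close>

definition feedback_seq :: "(bool list \<Rightarrow> bool list) \<Rightarrow> (nat \<Rightarrow> bool list) \<Rightarrow> binseq" where
  "feedback_seq c x = Binseq (\<lambda>n. feedback c x (Suc n) ! n)"

definition zero_extend :: "bool list \<Rightarrow> binseq" where
  "zero_extend xs = Binseq (\<lambda>k. k < length xs \<and> xs ! k)"

lemma prefix_of_zero_extend [simp]: "prefix_of (length xs) (zero_extend xs) = xs"
  by (rule nth_equalityI) (auto simp: zero_extend_def)

context
  fixes c :: "bool list \<Rightarrow> bool list" and x :: "nat \<Rightarrow> bool list" and l p :: nat
  assumes x: "length (x k) = l" and c: "length (c xs) = p"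
begin

lemma length_feedback: "length (feedback c x k) = k * (l + p)"
  by (induction k) (simp_all add: x c algebra_simps)

lemma nth_feedback_add: "n < k * (l + p) \<Longrightarrow> feedback c x (k + j) ! n = feedback c x k ! n"
proof (induction j)
  case (Suc j)
  then have "n < length (feedback c x (k + j))"
    by (simp add: length_feedback algebra_simps)
  with Suc show ?case by (simp add: nth_append)
qed simp

lemma prefix_of_feedback_seq: "prefix_of (k * (l + p)) (feedback_seq c x) = feedback c x k"
proof (rule nth_equalityI)
  fix n assume "n < length (prefix_of (k * (l + p)) (feedback_seq c x))"
  then have n: "n < k * (l + p)" by simp
  then have "Suc n \<le> Suc n * (l + p)" by (cases "l + p") auto
  then have n': "n < Suc n * (l + p)" by simp
  have "feedback c x (Suc n) ! n = feedback c x k ! n"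
    using nth_feedback_add[OF n, of "Suc n"] nth_feedback_add[OF n', of k]
    by (simp only: add.commute)
  with n show "prefix_of (k * (l + p)) (feedback_seq c x) ! n = feedback c x k ! n"
    by (simp add: feedback_seq_def del: feedback.simps)
qed (simp add: length_feedback)

lemma prefix_of_shift_feedback_seq:
  "prefix_of l ((shift ^^ (k * (l + p))) (feedback_seq c x)) = x k"
  "prefix_of p ((shift ^^ l) ((shift ^^ (k * (l + p))) (feedback_seq c x))) = c (feedback c x k)"
proof -
  have "prefix_of (k * (l + p) + (l + p)) (feedback_seq c x) = feedback c x (Suc k)"
    using prefix_of_feedback_seq[of "Suc k"] by (simp add: add.commute)
  then have "prefix_of l ((shift ^^ (k * (l + p))) (feedback_seq c x)) @
      prefix_of p ((shift ^^ l) ((shift ^^ (k * (l + p))) (feedback_seq c x))) = x k @ c (feedback c x k)"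
    by (simp add: prefix_of_add prefix_of_feedback_seq)
  then show "prefix_of l ((shift ^^ (k * (l + p))) (feedback_seq c x)) = x k"
    "prefix_of p ((shift ^^ l) ((shift ^^ (k * (l + p))) (feedback_seq c x))) = c (feedback c x k)"
    by (simp_all add: append_eq_append_conv x)
qed

end

text \<open>
  Words from \<open>W\<close> are inserted freely; after each of them a control word \<open>hi\<close> or \<open>lo\<close> steers the
  Birkhoff sum back towards its target. The control has to be chosen from the finite prefix built so
  far; completing that prefix by zeros changes its Birkhoff sum only sublinearly.
\<close>

lemma hausdorff_dim_birkhoff_level_ge:
  assumes W: "W \<subseteq> {xs. length xs = l}" "W \<noteq> {}"
    and hi: "length hi = p" and lo: "length lo = p" and R: "l + p > 0"
    and up: "\<And>w. prefix_of l w \<in> W \<Longrightarrow> prefix_of p ((shift ^^ l) w) = hi \<Longrightarrow> bsum f (l + p) w \<ge> real (l + p) * a"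
    and down: "\<And>w. prefix_of l w \<in> W \<Longrightarrow> prefix_of p ((shift ^^ l) w) = lo \<Longrightarrow> bsum f (l + p) w \<le> real (l + p) * a"
  shows "ereal (log 2 (card W) / real (l + p)) \<le> hausdorff_dim (birkhoff_level f a)"
proof -
  define c where "c xs = (if bsum f (length xs) (zero_extend xs) < real (length xs) * a then hi else lo)" for xs
  have c: "length (c xs) = p" for xs by (simp add: c_def hi lo)
  let ?R = "l + p"
  show ?thesis
  proof (rule hausdorff_dim_ge[where \<Phi> = "feedback_seq c"])
    show "finite W"
      using W(1) finite_lists_length_eq[of "UNIV :: bool set" l] by (auto intro: finite_subset)
  next
    fix x y :: "nat \<Rightarrow> bool list" and n j
    assume x: "\<And>k. x k \<in> W" and y: "\<And>k. y k \<in> W" and agr: "agree (n * ?R) (feedback_seq c x) (feedback_seq c y)"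
      and j: "j < n"
    have len: "length (x k) = l" "length (y k) = l" for k using x y W by auto
    have "Suc j * ?R \<le> n * ?R" using j by (intro mult_right_mono) auto
    then have "j * ?R + l \<le> n * ?R" by (simp add: algebra_simps)
    then have "agree l ((shift ^^ (j * ?R)) (feedback_seq c x)) ((shift ^^ (j * ?R)) (feedback_seq c y))"
      using agr by (auto simp: agree_def)
    then show "x j = y j"
      using prefix_of_shift_feedback_seq(1)[of x l c p j] prefix_of_shift_feedback_seq(1)[of y l c p j]
      by (simp add: len c prefix_of_eq_iff[symmetric])
  next
    fix x :: "nat \<Rightarrow> bool list" assume x: "\<And>k. x k \<in> W"
    have len: "length (x k) = l" for k using x W by auto
    let ?w = "feedback_seq c x"
    note pre = prefix_of_feedback_seq[of x l c p, OF len c]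
    note pre' = prefix_of_shift_feedback_seq[of x l c p, OF len c]
    note lenf = length_feedback[of x l c p, OF len c]
    show "?w \<in> birkhoff_level f a"
    proof (rule birkhoff_levelI)
      fix e :: real assume e: "e > 0"
      obtain C where C: "C \<ge> 0" "\<And>n v w. agree n v w \<Longrightarrow> \<bar>bsum f n v - bsum f n w\<bar> \<le> e * real n + C"
        using bsum_distortion[OF e, of f] by blast
      define X where "X k = bsum f (k * ?R) ?w - real (k * ?R) * a" for k
      define B where "B = real ?R * (norm f + \<bar>a\<bar>)"
      have B: "\<bar>bsum f n v - real n * a\<bar> \<le> B" if "n \<le> ?R" for n v
      proof -
        have "\<bar>bsum f n v - real n * a\<bar> \<le> \<bar>bsum f n v\<bar> + real n * \<bar>a\<bar>"
          using abs_triangle_ineq4[of "bsum f n v" "real n * a"] by (simp add: abs_mult)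
        also have "\<dots> \<le> real n * norm f + real n * \<bar>a\<bar>"
          using abs_bsum_le[of f n v] by simp
        also have "\<dots> \<le> B"
          unfolding B_def distrib_left using that by (intro add_mono mult_right_mono) auto
        finally show ?thesis .
      qed
      \<comment> \<open>The control sees the deviation only up to ?E + C. If it chooses
        \<open>hi\<close>, the true deviation is at most ?E + C and the next block raises it by an
        amount between 0 and B; \<open>lo\<close> is symmetric. Corrections therefore never
        overshoot the stated bound.\<close>
      have X: "\<bar>X k\<bar> \<le> e * real (k * ?R) + C + B" for k
      proof (induction k)
        case 0
        then show ?case using C B[of 0] by (simp add: X_def)
      next
        case (Suc k)
        let ?v = "(shift ^^ (k * ?R)) ?w"
        let ?D = "bsum f ?R ?v - real ?R * a"
        let ?E = "e * real (k * ?R)"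
        have step: "X (Suc k) = X k + ?D"
          using bsum_add[of f "k * ?R" ?R ?w] by (simp add: X_def algebra_simps)
        have W': "prefix_of l ?v \<in> W"
          using pre'(1)[of k] x by simp
        have "prefix_of (k * ?R) ?w = prefix_of (k * ?R) (zero_extend (feedback c x k))"
          using pre[of k] prefix_of_zero_extend[of "feedback c x k"] lenf[of k] by simp
        then have near: "\<bar>bsum f (k * ?R) ?w - bsum f (k * ?R) (zero_extend (feedback c x k))\<bar> \<le> ?E + C"
          by (intro C(2)) (simp add: prefix_of_eq_iff)
        have mono: "?E \<le> e * real (Suc k * ?R)"
          using e by (intro mult_left_mono) auto
        show ?case
        proof (cases "bsum f (k * ?R) (zero_extend (feedback c x k)) < real (k * ?R) * a")
          case True
          then have "c (feedback c x k) = hi"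
            by (simp only: c_def lenf if_True)
          then have "?D \<ge> 0"
            using up[OF W'] pre'(2)[of k] by simp
          moreover have "X k \<le> ?E + C"
            using True near by (simp only: X_def)
          ultimately show ?thesis
            using step Suc.IH B[of ?R ?v] mono by linarith
        next
          case False
          then have "c (feedback c x k) = lo"
            by (simp only: c_def lenf if_False)
          then have "?D \<le> 0"
            using down[OF W'] pre'(2)[of k] by simp
          moreover have "X k \<ge> - (?E + C)"
            using False near by (simp only: X_def)
          ultimately show ?thesis
            using step Suc.IH B[of ?R ?v] mono by linarith
        qed
      qed
      have "\<bar>bsum f n ?w - real n * a\<bar> \<le> e * real n + (C + 2 * B)" for n
      proof -
        let ?k = "n div ?R" and ?r = "n mod ?R"
        have n: "n = ?k * ?R + ?r" by (rule div_mult_mod_eq[symmetric])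
        have "bsum f (i + r) ?w - real (i + r) * a
            = (bsum f i ?w - real i * a) + (bsum f r ((shift ^^ i) ?w) - real r * a)" for i r
          by (simp add: bsum_add algebra_simps)
        from this[of "?k * ?R" ?r]
        have "bsum f n ?w - real n * a = X ?k + (bsum f ?r ((shift ^^ (?k * ?R)) ?w) - real ?r * a)"
          unfolding n[symmetric] X_def .
        moreover have "?r \<le> ?R" using R by (intro less_imp_le mod_less_divisor)
        moreover have "e * real (?k * ?R) \<le> e * real n"
          using e by (intro mult_left_mono of_nat_mono) auto
        ultimately show ?thesis
          using X[of ?k] B[of ?r "(shift ^^ (?k * ?R)) ?w"] by linarith
      qed
      then show "\<exists>C. \<forall>n. \<bar>bsum f n ?w - real n * a\<bar> \<le> e * real n + C" by blast
    qed
  qed (use W R in auto)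
qed

text \<open>The loss C is per word, not per letter. The bound is required for every continuation of
  the word, so losses simply add under concatenation, without boundary terms.\<close>

definition high_words :: "(binseq \<Rightarrow>\<^sub>C real) \<Rightarrow> real \<Rightarrow> nat \<Rightarrow> bool list set \<Rightarrow> bool" where
  "high_words f C l W \<longleftrightarrow> W \<subseteq> {xs. length xs = l} \<and>
     (\<forall>w. prefix_of l w \<in> W \<longrightarrow> bsum f l w \<ge> real l * alpha_max f - C)"

lemma high_words_concat:
  assumes "high_words f C l W"
  shows "\<exists>V. high_words f (real j * C) (j * l) V \<and> card V = card W ^ j"
proof (induction j)
  case 0
  have "high_words f 0 0 {[]}"
    by (simp add: high_words_def)
  then show ?case by (intro exI[of _ "{[]}"]) simp
next
  case (Suc j)
  then obtain V where V: "high_words f (real j * C) (j * l) V" "card V = card W ^ j" by blast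
  let ?V = "(\<lambda>(u, v). u @ v) ` (W \<times> V)"
  have len: "length u = l" if "u \<in> W" for u
    using assms that by (auto simp: high_words_def)
  have "inj_on (\<lambda>(u, v). u @ v) (W \<times> V)"
    using len by (auto simp: inj_on_def)
  then have "card ?V = card W ^ Suc j"
    using V by (simp add: card_image card_cartesian_product)
  moreover have "high_words f (real (Suc j) * C) (Suc j * l) ?V"
    unfolding high_words_def
  proof (intro conjI allI impI)
    show "?V \<subseteq> {xs. length xs = Suc j * l}"
      using V assms unfolding high_words_def by fastforce
  next
    fix w assume "prefix_of (Suc j * l) w \<in> ?V"
    then obtain u v where u: "u \<in> W" "v \<in> V" "prefix_of (l + j * l) w = u @ v" by auto
    then have "prefix_of l w = u" "prefix_of (j * l) ((shift ^^ l) w) = v"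
      using len[OF u(1)] by (simp_all add: prefix_of_add)
    then have "bsum f l w \<ge> real l * alpha_max f - C"
      "bsum f (j * l) ((shift ^^ l) w) \<ge> real (j * l) * alpha_max f - real j * C"
      using u V assms by (auto simp: high_words_def)
    then show "bsum f (Suc j * l) w \<ge> real (Suc j * l) * alpha_max f - real (Suc j) * C"
      by (simp add: bsum_add algebra_simps)
  qed
  ultimately show ?case by blast
qed

text \<open>In the summand 2, one unit comes from z, whose sum may miss l * alpha_max u by 1, and
  one from exchanging u and g at w and at z, 1/2 each. The rest is the cost of one flip for
  g.\<close>

lemma exists_high_words:
  assumes g: "depends_on m g" and l: "l > 0" and u: "dist u g < 1 / (2 * real l)"
  shows "\<exists>W. high_words u (4 * real m * norm g + 2) l W \<and> card W = l"
proof -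
  obtain z where z: "bsum u l z \<ge> real l * (alpha_max u - 1 / real l)"
    using exists_bsum_ge[of "alpha_max u - 1 / real l" u l] l by auto
  define flip where "flip i = (prefix_of l z)[i := \<not> coord z i]" for i
  have nth: "flip i ! k = (if k = i then \<not> coord z i else coord z k)" if "k < l" for i k
    using that by (simp add: flip_def nth_list_update)
  have len: "length (flip i) = l" for i by (simp add: flip_def)
  have "inj_on flip {..<l}"
  proof (rule inj_onI, rule ccontr)
    fix i j assume ij: "i \<in> {..<l}" "flip i = flip j" "i \<noteq> j"
    then have "flip i ! i = flip j ! i" by simp
    with ij nth[of i i] nth[of i j] show False by simp
  qed
  then have "card (flip ` {..<l}) = l" by (simp add: card_image)
  moreover have "high_words u (4 * real m * norm g + 2) l (flip ` {..<l})"
    unfolding high_words_def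
  proof (intro conjI allI impI)
    show "flip ` {..<l} \<subseteq> {xs. length xs = l}" using len by auto
  next
    fix w assume "prefix_of l w \<in> flip ` {..<l}"
    then obtain i where i: "prefix_of l w = flip i" by blast
    have "coord w k = coord z k" if "k < l" "k \<noteq> i" for k
      using nth[of k i] that nth_prefix_of[of k l w] i by simp
    then have "\<bar>bsum g l w - bsum g l z\<bar> \<le> 4 * real m * norm g"
      by (rule bsum_depends_on[OF g])
    moreover have "\<bar>bsum u l v - bsum g l v\<bar> \<le> 1 / 2" for v
    proof -
      have "\<bar>bsum u l v - bsum g l v\<bar> \<le> real l * dist u g" by (rule bsum_dist_le)
      also have "\<dots> \<le> real l * (1 / (2 * real l))"
        using u by (intro mult_left_mono) auto
      finally show ?thesis using l by simp
    qed
    note this[of w] this[of z]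
    moreover have "real l * (alpha_max u - 1 / real l) = real l * alpha_max u - 1"
      using l by (simp add: algebra_simps)
    ultimately show "bsum u l w \<ge> real l * alpha_max u - (4 * real m * norm g + 2)"
      using z by linarith
  qed
  ultimately show ?thesis by blast
qed

text \<open>Where the spectrum vanishes at \<open>alpha_max f\<close>, this forces difference
  quotients at most -M on a left neighbourhood.\<close>

definition steep_below :: "real \<Rightarrow> (binseq \<Rightarrow>\<^sub>C real) \<Rightarrow> bool" where
  "steep_below M f \<longleftrightarrow>
     (\<exists>\<delta>>0. \<forall>t. 0 < t \<longrightarrow> t < \<delta> \<longrightarrow> M * t \<le> birkhoff_spectrum f (alpha_max f - t))"

lemma birkhoff_spectrum_ge:
  assumes "ereal r \<le> hausdorff_dim (birkhoff_level f a)"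
  shows "r \<le> birkhoff_spectrum f a"
proof -
  have "\<bar>hausdorff_dim (birkhoff_level f a)\<bar> \<noteq> \<infinity>"
    using hausdorff_dim_binseq[of "birkhoff_level f a"] by (auto simp: abs_eq_infinity_cases)
  with assms show ?thesis
    unfolding birkhoff_spectrum_def by (simp add: ereal_le_real_iff)
qed

text \<open>A block consists of j free words and a control of length p, about 2 * j * C / t. For
  small t, t times the block length is at most 3 * j * C, while the free words give j * log 2 (card
  W) bits; this is the origin of the factor 3. The point z with a strictly smaller average supplies
  the lowering control.\<close>

lemma steep_belowI:
  assumes W: "high_words f C l W" and C: "C > 0" and M: "M > 0" and cardW: "card W > 0" and large: "3 * M * C \<le> log 2 (card W)"
    and z: "z \<in> birkhoff_level f b" and b: "b < alpha_max f"
  shows "steep_below M f"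
proof -
  define A where "A = alpha_max f"
  define \<gamma> where "\<gamma> = (A - b) / 2"
  define N where "N = norm f"
  have \<gamma>: "\<gamma> > 0" using b by (simp add: \<gamma>_def A_def)
  have N: "N \<ge> 0" "\<bar>A\<bar> \<le> N" using abs_alpha_max_le[of f] by (auto simp: N_def A_def)
  \<comment> \<open>The conditions keep a gap \<gamma>/2 for the lowering control, let that control
    outweigh the free words, and bound the contribution of their length j * l to the block.\<close>
  define \<delta> where "\<delta> = min (min 1 (\<gamma> / 2)) (min (C * \<gamma> / (real (Suc l) * (2 * N + 1))) (C / real (Suc l)))"
  have \<delta>: "\<delta> > 0" using \<gamma> C N by (simp add: \<delta>_def)
  have "M * t \<le> birkhoff_spectrum f (A - t)" if t: "0 < t" "t < \<delta>" for t
  proof (rule birkhoff_spectrum_ge)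
    have t1: "t \<le> 1" "t \<le> \<gamma> / 2" and "t \<le> C * \<gamma> / (real (Suc l) * (2 * N + 1))" "t \<le> C / real (Suc l)"
      using t by (auto simp: \<delta>_def)
    then have t2: "t * (real (Suc l) * (2 * N + 1)) \<le> C * \<gamma>" and t3: "t * real (Suc l) \<le> C"
      using N by (simp_all add: pos_le_divide_eq)
    obtain D where D: "D \<ge> 0" "\<And>n v w. agree n v w \<Longrightarrow> \<bar>bsum f n v - bsum f n w\<bar> \<le> t / 8 * real n + D"
      using bsum_distortion[of "t / 8" f] t by auto
    have "\<forall>\<^sub>F n in sequentially. bsum f n z / real n < b + \<gamma> / 2"
      using z \<gamma> unfolding birkhoff_level_iff by (intro order_tendstoD(2)) auto
    then obtain n0 where n0: "\<And>n. n \<ge> n0 \<Longrightarrow> bsum f n z / real n < b + \<gamma> / 2"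
      by (auto simp: eventually_sequentially)
    \<comment> \<open>Taking many free words per block makes p exceed n0 and 8 * D / t, so that z
      shows its smaller average and the distortion constant D is at most t * p / 8.\<close>
    obtain j where j: "real j > (8 * D / t + real n0 + 1) * t / (2 * C)"
      using reals_Archimedean2 by blast
    define p where "p = nat \<lceil>2 * real j * C / t\<rceil>"
    have nonneg: "2 * real j * C / t \<ge> 0" using t C by simp
    have p: "2 * real j * C / t \<le> real p" "real p \<le> 2 * real j * C / t + 1"
      using nonneg by (simp_all add: p_def)
    have "8 * D / t + real n0 + 1 < 2 * real j * C / t"
      using j t C by (simp add: field_simps)
    then have big: "8 * D / t + real n0 + 1 < real p" using p by linarith
    have "0 \<le> 8 * D / t" using D t by simp
    then have pn: "p \<ge> n0" "p > 0" "8 * D / t \<le> real p" using big by linarith+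
    then have pD: "D \<le> t / 8 * real p" using t by (simp add: field_simps)
    have pj: "2 * real j * C \<le> real p * t" using p t by (simp add: field_simps)
    have j1: "real j \<ge> 1"
    proof -
      have "real j > 0" using j \<open>0 \<le> 8 * D / t\<close> t C
        by (smt (verit) divide_nonneg_pos mult_nonneg_nonneg of_nat_0_le_iff)
      then show ?thesis by simp
    qed
    \<comment> \<open>The raising control loses p * t / 4 here and at most p * t / 4 by distortion.
      The free words lose j * C, at most p * t / 2, so the block stays within the allowed
      loss.\<close>
    obtain z1 where z1: "bsum f p z1 \<ge> real p * (A - t / 4)"
      using exists_bsum_ge[of "A - t / 4" f p] t by (auto simp: A_def)
    obtain V where V: "high_words f (real j * C) (j * l) V" "card V = card W ^ j"
      using high_words_concat[OF W] by blast
    have "V \<noteq> {}" using V cardW by auto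
    have "ereal (M * t) \<le> ereal (log 2 (card V) / real (j * l + p))"
    proof -
      have "real p * t \<le> 2 * real j * C + t"
        using mult_right_mono[OF p(2), of t] t by (simp add: distrib_right)
      then have "t * real (j * l + p) \<le> t * real j * real l + 2 * real j * C + t"
        by (simp add: algebra_simps)
      then have "M * t * real (j * l + p) \<le> M * (t * real j * real l + 2 * real j * C + t)"
        using M by (simp add: mult.assoc)
      also have "\<dots> \<le> M * (t * real j * real l + 2 * real j * C + t * real j)"
        using M t j1 by (intro mult_left_mono add_left_mono) auto
      also have "\<dots> = M * (real j * (t * real (Suc l) + 2 * C))"
        by (simp add: algebra_simps)
      also have "\<dots> \<le> M * (real j * (C + 2 * C))"
        using M t3 by (intro mult_left_mono add_right_mono) auto
      also have "\<dots> = real j * (3 * M * C)" by simp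
      also have "\<dots> \<le> real j * log 2 (card W)"
        using large by (intro mult_left_mono) auto
      also have "\<dots> = log 2 (card V)"
        using cardW by (simp add: V log_nat_power)
      finally have "M * t * real (j * l + p) \<le> log 2 (card V)" .
      moreover have "real (j * l + p) > 0" using pn(2) by (simp only: of_nat_0_less_iff add_gr_0 simp_thms)
      ultimately show ?thesis by (simp only: ereal_less_eq pos_le_divide_eq)
    qed
    also have "\<dots> \<le> hausdorff_dim (birkhoff_level f (A - t))"
    proof (rule hausdorff_dim_birkhoff_level_ge[where hi = "prefix_of p z1" and lo = "prefix_of p z"])
      show "V \<subseteq> {xs. length xs = j * l}" using V by (auto simp: high_words_def)
      show "V \<noteq> {}" by fact
      show "j * l + p > 0" using pn by simp
    next
      fix w assume w: "prefix_of (j * l) w \<in> V" "prefix_of p ((shift ^^ (j * l)) w) = prefix_of p z1"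
      have "bsum f (j * l) w \<ge> real (j * l) * A - real j * C"
        using V w by (auto simp: high_words_def A_def)
      moreover have "bsum f p ((shift ^^ (j * l)) w) \<ge> bsum f p z1 - (t / 8 * real p + D)"
        using D(2)[of p "(shift ^^ (j * l)) w" z1] w by (auto simp: prefix_of_eq_iff)
      moreover have "real (j * l) * t \<ge> 0" using t by simp
      ultimately show "bsum f (j * l + p) w \<ge> real (j * l + p) * (A - t)"
        using z1 pD pj unfolding bsum_add by (simp add: algebra_simps)
    next
      fix w assume w: "prefix_of (j * l) w \<in> V" "prefix_of p ((shift ^^ (j * l)) w) = prefix_of p z"
      have "bsum f (j * l) w \<le> real (j * l) * N"
        using abs_bsum_le[of f "j * l" w] by (simp add: N_def)
      moreover have "bsum f p ((shift ^^ (j * l)) w) \<le> bsum f p z + (t / 8 * real p + D)"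
        using D(2)[of p "(shift ^^ (j * l)) w" z] w by (auto simp: prefix_of_eq_iff)
      moreover have "bsum f p z \<le> real p * (b + \<gamma> / 2)"
        using n0[OF pn(1)] pn(2) by (simp add: field_simps)
      moreover have "t / 4 * real p \<le> \<gamma> / 8 * real p"
        using t1 by (intro mult_right_mono) auto
      \<comment> \<open>The free words can exceed the target A - t by at most N - A + t per letter;
        half of the gap \<gamma> over the p control letters absorbs this.\<close>
      moreover have "real (j * l) * (N - A + t) \<le> real p * (\<gamma> / 2)"
      proof -
        have "real (j * l) * (N - A + t) \<le> real j * (real (Suc l) * (2 * N + 1))"
          unfolding of_nat_mult mult.assoc using N t1 t
          by (intro mult_left_mono mult_mono) auto
        moreover have "t * (real j * (real (Suc l) * (2 * N + 1))) \<le> t * (real p * (\<gamma> / 2))"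
        proof -
          have "t * (real j * (real (Suc l) * (2 * N + 1))) \<le> real j * (C * \<gamma>)"
            using mult_left_mono[OF t2, of "real j"] by (simp add: mult_ac)
          also have "\<dots> = 2 * real j * C * (\<gamma> / 2)" by simp
          also have "\<dots> \<le> real p * t * (\<gamma> / 2)"
            using pj \<gamma> by (intro mult_right_mono) auto
          finally show ?thesis by (simp add: mult_ac)
        qed
        ultimately show ?thesis
          unfolding mult_le_cancel_left_pos[OF t(1)] by linarith
      qed
      moreover have "real p * (\<gamma> / 2) \<le> real p * (\<gamma> - t)"
        using t1 by (intro mult_left_mono) auto
      moreover have "real p * (b + \<gamma> / 2) + \<gamma> / 8 * real p \<le> real p * (A - \<gamma>)"
      proof -
        have "real p * (b + \<gamma> / 2 + \<gamma> / 8) \<le> real p * (A - \<gamma>)"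
          using \<gamma> by (intro mult_left_mono) (auto simp: \<gamma>_def field_simps)
        then show ?thesis by (simp add: algebra_simps)
      qed
      ultimately have "bsum f (j * l) w + bsum f p ((shift ^^ (j * l)) w)
          \<le> real (j * l) * (A - t) + real p * (A - t)"
        using pD unfolding right_diff_distrib distrib_left by linarith
      then show "bsum f (j * l + p) w \<le> real (j * l + p) * (A - t)"
        by (simp add: bsum_add distrib_right)
    qed simp_all
    finally show "ereal (M * t) \<le> hausdorff_dim (birkhoff_level f (A - t))" .
  qed
  with \<delta> show ?thesis unfolding steep_below_def A_def by blast
qed

lemma fixed_point_birkhoff_level: "Binseq (\<lambda>_. b) \<in> birkhoff_level f (apply_bcontfun f (Binseq (\<lambda>_. b)))"
proof -
  have "(shift ^^ 1) (Binseq (\<lambda>_. b)) = Binseq (\<lambda>_. b)"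
    by (rule binseq_eqI) (simp only: coord_funpow_shift coord_Binseq)
  from periodic_birkhoff_level[OF _ this, of f] show ?thesis by (simp add: bsum_def)
qed

text \<open>Some level strictly below the maximum must exist, and persist under perturbation. The
  two constant sequences provide it once h separates them; if g does not, a small bonus for the
  letter 1 does.\<close>

lemma exists_steep_below:
  assumes g: "depends_on m g" and e: "e > 0" and M: "M > 0"
  shows "\<exists>h d. d > 0 \<and> dist h g < e \<and> (\<forall>u. dist u h < d \<longrightarrow> steep_below M u)"
proof -
  let ?z = "\<lambda>b. Binseq (\<lambda>_. b)"
  obtain m' h where h: "depends_on m' h" "dist h g < e"
    "apply_bcontfun h (?z False) \<noteq> apply_bcontfun h (?z True)"
  proof (cases "apply_bcontfun g (?z False) = apply_bcontfun g (?z True)")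
    case False
    with g e that[of m g] show ?thesis by simp
  next
    case True
    let ?h = "\<lambda>w. apply_bcontfun g w + e / 2 * of_bool (coord w 0)"
    have "?h v = ?h w" if "agree (Suc m) v w" for v w
      using g that agree_mono[OF that, of m] by (simp add: depends_on_def) (simp add: agree_def)
    from obtain_depends_on[of "Suc m" ?h, OF this]
    obtain h where h: "depends_on (Suc m) h" "\<And>w. apply_bcontfun h w = ?h w" by blast
    have "dist h g \<le> e / 2"
      by (rule dist_bound) (use e in \<open>simp add: h dist_real_def\<close>)
    with h e True that[of "Suc m" h] show ?thesis by simp
  qed
  define C where "C = 4 * real m' * norm h + 2"
  have C: "C > 0" by (simp add: C_def add_nonneg_pos)
  \<comment> \<open>This choice is possible because C was fixed from h before l.\<close>
  obtain l where large: "real l > 2 powr (3 * M * C)" using reals_Archimedean2 by blast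
  have "(0 :: real) < 2 powr (3 * M * C)" by simp
  with large have pos: "real l > 0" by linarith
  have l: "l > 0" "3 * M * C \<le> log 2 l"
    using pos large le_log_iff[of 2 "real l" "3 * M * C"] by auto
  \<comment> \<open>The first bound keeps the loss of the flipped words at C, the second keeps the
    values at the two fixed points distinct.\<close>
  define d where "d = min (1 / (2 * real l)) (\<bar>apply_bcontfun h (?z False) - apply_bcontfun h (?z True)\<bar> / 2)"
  have "steep_below M u" if u: "dist u h < d" for u
  proof -
    obtain W where W: "high_words u C l W" "card W = l"
      using exists_high_words[OF h(1) l(1), of u] u unfolding C_def d_def by auto
    have "\<bar>apply_bcontfun u w - apply_bcontfun h w\<bar>
        < \<bar>apply_bcontfun h (?z False) - apply_bcontfun h (?z True)\<bar> / 2" for w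
      using dist_bounded[of u w h] u by (simp add: dist_real_def d_def)
    from this[of "?z False"] this[of "?z True"]
    have ne: "apply_bcontfun u (?z False) \<noteq> apply_bcontfun u (?z True)"
      by (auto simp: abs_if split: if_splits)
    have "apply_bcontfun u (?z b) \<le> alpha_max u" for b
      using fixed_point_birkhoff_level[of b u] by (intro le_alpha_max) blast
    from this[of False] this[of True] ne
    obtain b where "apply_bcontfun u (?z b) < alpha_max u"
      by (metis order_le_less)
    from steep_belowI[OF W(1) C M _ _ fixed_point_birkhoff_level this] l W show ?thesis by simp
  qed
  moreover have "d > 0" using l h by (simp add: d_def)
  ultimately show ?thesis using h by blast
qed

section \<open>Reflection between the maximal and the minimal level\<close>

lemma birkhoff_level_uminus: "birkhoff_level (- f) a = birkhoff_level f (- a)"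
proof -
  have "(\<lambda>n. - (bsum f n w / real n)) \<longlonglongrightarrow> a \<longleftrightarrow> (\<lambda>n. bsum f n w / real n) \<longlonglongrightarrow> - a" for w
    using tendsto_minus_cancel_left[of "\<lambda>n. bsum f n w / real n" a sequentially]
    by (simp add: tendsto_minus_cancel_left)
  then show ?thesis
    by (auto simp: birkhoff_level_iff bsum_uminus)
qed

lemma alpha_min_eq: "alpha_min f = - alpha_max (- f)"
proof -
  have "uminus ` {a. Q a} = {a. Q (- a)}" for Q :: "real \<Rightarrow> bool"
  proof (intro set_eqI iffI)
    fix a assume "a \<in> {a. Q (- a)}"
    then show "a \<in> uminus ` {a. Q a}" by (intro image_eqI[of _ _ "- a"]) auto
  qed auto
  from this[of "\<lambda>a. birkhoff_level f a \<noteq> {}"]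
  have "uminus ` {a. birkhoff_level f a \<noteq> {}} = {a. birkhoff_level (- f) a \<noteq> {}}"
    by (simp only: birkhoff_level_uminus)
  then show ?thesis
    by (simp add: alpha_min_def alpha_max_def Inf_real_def)
qed

section \<open>Generic behaviour\<close>

lemma birkhoff_spectrum_eq_0:
  assumes "\<And>k::nat. hausdorff_measure (1 / real (Suc k)) (birkhoff_level f a) = 0"
  shows "birkhoff_spectrum f a = 0"
proof -
  have "hausdorff_dim (birkhoff_level f a) \<le> ereal (1 / real (Suc k))" for k
    unfolding hausdorff_dim_def using assms by (intro INF_lower) simp
  moreover have "(\<lambda>k. ereal (1 / real (Suc k))) \<longlonglongrightarrow> ereal 0"
    using LIMSEQ_inverse_real_of_nat by (intro tendsto_intros) (simp add: inverse_eq_divide)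
  ultimately have "hausdorff_dim (birkhoff_level f a) \<le> ereal 0"
    by (intro tendsto_lowerbound[of "\<lambda>k. ereal (1 / real (Suc k))"]) auto
  with hausdorff_dim_binseq(1)[of "birkhoff_level f a"] show ?thesis
    by (simp add: birkhoff_spectrum_def zero_ereal_def[symmetric])
qed

theorem theorem5p1p1:
  shows "generic (\<lambda>f :: binseq \<Rightarrow>\<^sub>C real.
           has_left_derivative (birkhoff_spectrum f) (-\<infinity>) (alpha_max f) \<and>
           has_right_derivative (birkhoff_spectrum f) \<infinity> (alpha_min f))"
proof -
  \<comment> \<open>Exponents 1/(k+1) and slopes k+1 reduce the two limiting statements to countably
    many conditions, each with dense interior.\<close>
  define P where "P k f \<longleftrightarrow> hausdorff_measure (1 / real (Suc k)) (birkhoff_level f (alpha_max f)) = 0 \<and>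
      steep_below (real (Suc k)) f" for k f
  have P: "dense_interior (P k)" for k
    unfolding P_def
    by (intro dense_interior_conj dense_interior_binseqI exists_null_maximal_level exists_steep_below) auto
  have steep: "\<exists>\<delta>>0. \<forall>t. 0 < t \<longrightarrow> t < \<delta> \<longrightarrow>
      M < (birkhoff_spectrum f (alpha_max f - t) - birkhoff_spectrum f (alpha_max f)) / t"
    if f: "\<And>k. P k f" for f M
  proof -
    have zero: "birkhoff_spectrum f (alpha_max f) = 0"
      using f by (intro birkhoff_spectrum_eq_0) (simp add: P_def)
    obtain k :: nat where k: "real k > M" using reals_Archimedean2 by blast
    obtain \<delta> where "\<delta> > 0" "\<And>t. 0 < t \<Longrightarrow> t < \<delta> \<Longrightarrow> real (Suc k) * t \<le> birkhoff_spectrum f (alpha_max f - t)"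
      using f[of k] unfolding P_def steep_below_def by blast
    moreover have "M < s / t" if "0 < t" "real (Suc k) * t \<le> s" for s t
    proof -
      have "M < real (Suc k)" using k by simp
      also have "\<dots> \<le> s / t" using that by (simp add: pos_le_divide_eq)
      finally show ?thesis .
    qed
    ultimately show ?thesis by (intro exI[of _ \<delta>]) (simp add: zero)
  qed
  show ?thesis
  proof (rule genericI)
    \<comment> \<open>Negation is an isometry, so the conditions on -f, which govern the minimal
      level, have dense interior as well.\<close>
    show "dense_interior (\<lambda>f. P k f \<and> P k (- f))" for k
      by (intro dense_interior_conj dense_interior_uminus P)
  next
    fix f assume f: "\<And>k. P k f \<and> P k (- f)"
    have "has_left_derivative (birkhoff_spectrum f) (-\<infinity>) (alpha_max f)"
      unfolding has_left_derivative_def tendsto_MInfty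
    proof
      fix r
      obtain \<delta> where \<delta>: "\<delta> > 0" "\<And>t. 0 < t \<Longrightarrow> t < \<delta> \<Longrightarrow>
          - r < (birkhoff_spectrum f (alpha_max f - t) - birkhoff_spectrum f (alpha_max f)) / t"
        using steep[of f "- r"] f by blast
      show "\<forall>\<^sub>F x in at_left (alpha_max f). ereal ((birkhoff_spectrum f x - birkhoff_spectrum f (alpha_max f)) / (x - alpha_max f)) < ereal r"
        unfolding eventually_at_left_field
      proof (intro exI[of _ "alpha_max f - \<delta>"] conjI allI impI)
        fix x assume "alpha_max f - \<delta> < x" "x < alpha_max f"
        then have "- r < (birkhoff_spectrum f x - birkhoff_spectrum f (alpha_max f)) / (alpha_max f - x)"
          using \<delta>(2)[of "alpha_max f - x"] by simp
        then have "- ((birkhoff_spectrum f x - birkhoff_spectrum f (alpha_max f)) / (alpha_max f - x)) < r"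
          by simp
        then show "ereal ((birkhoff_spectrum f x - birkhoff_spectrum f (alpha_max f)) / (x - alpha_max f)) < ereal r"
          by (simp only: divide_minus_right[symmetric] minus_diff_eq ereal_less(1) less_ereal.simps)
      qed (use \<delta> in simp)
    qed
    moreover have "has_right_derivative (birkhoff_spectrum f) \<infinity> (alpha_min f)"
      unfolding has_right_derivative_def tendsto_PInfty
    proof
      fix r
      have spec: "birkhoff_spectrum f x = birkhoff_spectrum (- f) (- x)" for x
        by (simp add: birkhoff_spectrum_def birkhoff_level_uminus)
      obtain \<delta> where \<delta>: "\<delta> > 0" "\<And>t. 0 < t \<Longrightarrow> t < \<delta> \<Longrightarrow>
          r < (birkhoff_spectrum (- f) (alpha_max (- f) - t) - birkhoff_spectrum (- f) (alpha_max (- f))) / t"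
        using steep[of "- f" r] f by blast
      show "\<forall>\<^sub>F x in at_right (alpha_min f). ereal r < ereal ((birkhoff_spectrum f x - birkhoff_spectrum f (alpha_min f)) / (x - alpha_min f))"
        unfolding eventually_at_right_field
      proof (intro exI[of _ "alpha_min f + \<delta>"] conjI allI impI)
        fix x assume "alpha_min f < x" "x < alpha_min f + \<delta>"
        then show "ereal r < ereal ((birkhoff_spectrum f x - birkhoff_spectrum f (alpha_min f)) / (x - alpha_min f))"
          using \<delta>(2)[of "x - alpha_min f"] by (simp add: spec alpha_min_eq)
      qed (use \<delta> in simp)
    qed
    ultimately show "has_left_derivative (birkhoff_spectrum f) (-\<infinity>) (alpha_max f) \<and>
        has_right_derivative (birkhoff_spectrum f) \<infinity> (alpha_min f)" ..
  qed
qed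

end
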